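(* Activation Edge-Cover with unit thresholds admits ratio $\frac{1555}{1347}$.
   Context: Activation Edge-Cover: given a multigraph $G=(V,E)$, terminals $R\subseteq V$, and thresholds $\{t^e_u,t^e_v\}$ for each $uv$-edge $e$, find an assignment ${\bf a}$ of minimum $\sum_v a_v$ such that $\{e=uv: a_u\ge t^e_u,a_v\ge t^e_v\}$ covers $R$ (every terminal is incident to an activated edge). Unit thresholds means $t^e_u=t^e_v=1$ for every $uv$-edge $e$. *)

theory Defs
  imports Complex_Main "HOL-Computational_Algebra.Polynomial"
begin

text \<open>
  Undirected multigraphs: parallel edges are distinct elements of \<open>edges\<close> with the same
  endpoint set. A one-element endpoint set is a loop; loops are allowed, loopless multigraphs
  being a special case. \<open>thr e u\<close> is only meaningful for \<open>u \<in> ends e\<close>.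
\<close>

record ('v, 'e) activation_instance =
  verts :: "'v set"
  edges :: "'e set"
  ends :: "'e \<Rightarrow> 'v set"
  terminals :: "'v set"
  thr :: "'e \<Rightarrow> 'v \<Rightarrow> real"

definition valid_instance :: "('v, 'e) activation_instance \<Rightarrow> bool" where
  "valid_instance I \<longleftrightarrow>
     finite (verts I) \<and> finite (edges I) \<and>
     (\<forall>e\<in>edges I. ends I e \<subseteq> verts I \<and> ends I e \<noteq> {} \<and> card (ends I e) \<le> 2) \<and>
     terminals I \<subseteq> verts I \<and>
     (\<forall>e\<in>edges I. \<forall>u\<in>ends I e. 0 \<le> thr I e u)"

definition unit_thresholds :: "('v, 'e) activation_instance \<Rightarrow> bool" where
  "unit_thresholds I \<longleftrightarrow> (\<forall>e\<in>edges I. \<forall>u\<in>ends I e. thr I e u = 1)"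

definition activated_edges :: "('v, 'e) activation_instance \<Rightarrow> ('v \<Rightarrow> real) \<Rightarrow> 'e set" where
  "activated_edges I a = {e \<in> edges I. \<forall>u\<in>ends I e. thr I e u \<le> a u}"

definition covers :: "('v, 'e) activation_instance \<Rightarrow> 'e set \<Rightarrow> 'v set \<Rightarrow> bool" where
  "covers I F R \<longleftrightarrow> (\<forall>v\<in>R. \<exists>e\<in>F. v \<in> ends I e)"

definition edge_cover_assignments :: "('v, 'e) activation_instance \<Rightarrow> ('v \<Rightarrow> real) set" where
  "edge_cover_assignments I =
     {a. (\<forall>v\<in>verts I. 0 \<le> a v) \<and> covers I (activated_edges I a) (terminals I)}"

definition assignment_value :: "('v, 'e) activation_instance \<Rightarrow> ('v \<Rightarrow> real) \<Rightarrow> real" where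
  "assignment_value I a = (\<Sum>v\<in>verts I. a v)"

text \<open>
  The machine model is a structured random access machine. Its memory consists of arrays of
  natural numbers (a program mentions only finitely many of them), and its arithmetic is
  restricted to addition and truncated subtraction. Every operation has unit cost; since there
  is no multiplication, a run of \<open>t\<close> steps increases the bit length of the stored numbers by
  \<open>O(t)\<close> only, so polynomial time on this machine is polynomial time on Turing machines.
\<close>

type_synonym store = "nat \<Rightarrow> nat \<Rightarrow> nat"

datatype aexp = Const nat | Get nat aexp | Plus aexp aexp | Monus aexp aexp

datatype bexp = Less aexp aexp | Equal aexp aexp | Neg bexp | Conj bexp bexp

datatype com =
    Skip
  | Put nat aexp aexp
  | Seq com com
  | Cond bexp com com
  | Loop bexp com

fun aval :: "aexp \<Rightarrow> store \<Rightarrow> nat" where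
  "aval (Const k) s = k"
| "aval (Get x i) s = s x (aval i s)"
| "aval (Plus a b) s = aval a s + aval b s"
| "aval (Monus a b) s = aval a s - aval b s"

fun acost :: "aexp \<Rightarrow> nat" where
  "acost (Const k) = 1"
| "acost (Get x i) = 1 + acost i"
| "acost (Plus a b) = 1 + acost a + acost b"
| "acost (Monus a b) = 1 + acost a + acost b"

fun bval :: "bexp \<Rightarrow> store \<Rightarrow> bool" where
  "bval (Less a b) s \<longleftrightarrow> aval a s < aval b s"
| "bval (Equal a b) s \<longleftrightarrow> aval a s = aval b s"
| "bval (Neg b) s \<longleftrightarrow> \<not> bval b s"
| "bval (Conj b c) s \<longleftrightarrow> bval b s \<and> bval c s"

fun bcost :: "bexp \<Rightarrow> nat" where
  "bcost (Less a b) = 1 + acost a + acost b"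
| "bcost (Equal a b) = 1 + acost a + acost b"
| "bcost (Neg b) = 1 + bcost b"
| "bcost (Conj b c) = 1 + bcost b + bcost c"

text \<open>\<open>exec c s t s'\<close>: started in \<open>s\<close>, the program \<open>c\<close> halts after \<open>t\<close> steps in \<open>s'\<close>.\<close>

inductive exec :: "com \<Rightarrow> store \<Rightarrow> nat \<Rightarrow> store \<Rightarrow> bool" where
  exec_Skip: "exec Skip s 1 s"
| exec_Put: "exec (Put x i a) s (1 + acost i + acost a)
    (s(x := (s x)(aval i s := aval a s)))"
| exec_Seq: "exec c s t s' \<Longrightarrow> exec d s' t' s'' \<Longrightarrow> exec (Seq c d) s (t + t') s''"
| exec_CondT: "bval b s \<Longrightarrow> exec c s t s' \<Longrightarrow> exec (Cond b c d) s (bcost b + t) s'"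
| exec_CondF: "\<not> bval b s \<Longrightarrow> exec d s t s' \<Longrightarrow> exec (Cond b c d) s (bcost b + t) s'"
| exec_LoopF: "\<not> bval b s \<Longrightarrow> exec (Loop b c) s (bcost b) s"
| exec_LoopT: "bval b s \<Longrightarrow> exec c s t s' \<Longrightarrow> exec (Loop b c) s' t' s'' \<Longrightarrow>
    exec (Loop b c) s (bcost b + t + t') s''"

lemma exec_deterministic:
  "exec c s t s' \<Longrightarrow> exec c s u s'' \<Longrightarrow> t = u \<and> s' = s''"
proof (induction arbitrary: u s'' rule: exec.induct)
  case (exec_Skip s)
  then show ?case by (auto elim: exec.cases)
next
  case (exec_Put x i a s)
  then show ?case by (auto elim: exec.cases)
next
  case (exec_Seq c s t s' d t' s'' u v)
  from exec_Seq.prems show ?case by cases (use exec_Seq.IH in blast)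
next
  case (exec_CondT b s c t s' d u v)
  from exec_CondT.prems show ?case by cases (use exec_CondT in blast)+
next
  case (exec_CondF b s d t s' c u v)
  from exec_CondF.prems show ?case by cases (use exec_CondF in blast)+
next
  case (exec_LoopF b s c u v)
  from exec_LoopF.prems show ?case by cases (use exec_LoopF in blast)+
next
  case (exec_LoopT b s c t s' t' s'' u v)
  from exec_LoopT.prems show ?case by cases (use exec_LoopT in blast)+
qed

text \<open>
  A minimization problem has a set of instances \<open>X\<close> and, for each instance, a set \<open>sols\<close> of
  feasible solutions valued by \<open>val\<close>. It admits ratio \<open>\<rho>\<close> if some program halts within time
  polynomial in \<open>sz\<close> on every instance and outputs, whenever the instance is feasible, a
  feasible solution of value at most \<open>\<rho>\<close> times the optimum. Here \<open>enc I s\<close> says that the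
  store \<open>s\<close> is an input representing \<open>I\<close>, and \<open>dec\<close> reads the output off the final store.
\<close>

definition admits_ratio ::
  "'i set \<Rightarrow> ('i \<Rightarrow> 'a set) \<Rightarrow> ('i \<Rightarrow> 'a \<Rightarrow> real) \<Rightarrow>
   ('i \<Rightarrow> nat) \<Rightarrow> ('i \<Rightarrow> store \<Rightarrow> bool) \<Rightarrow> (store \<Rightarrow> 'a) \<Rightarrow> real \<Rightarrow> bool" where
  "admits_ratio X sols val sz enc dec \<rho> \<longleftrightarrow>
     (\<exists>(c :: com) (p :: nat poly). \<forall>I\<in>X. \<forall>s. enc I s \<longrightarrow>
        (\<exists>t s'. exec c s t s' \<and> t \<le> poly p (sz I) \<and>
           (sols I \<noteq> {} \<longrightarrow>
              dec s' \<in> sols I \<and> val I (dec s') \<le> \<rho> * (INF x\<in>sols I. val I x))))"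

definition instance_size :: "('v, 'e) activation_instance \<Rightarrow> nat" where
  "instance_size I = card (verts I) + card (edges I)"

text \<open>
  Input format: the vertices are \<open>0, \<dots>, n - 1\<close> and the edges \<open>0, \<dots>, m - 1\<close>. Array 0 holds
  \<open>n\<close> and \<open>m\<close>, arrays 1 and 2 hold the two endpoints of each edge in either order, array 3
  is the characteristic vector of the terminals, and all other cells are 0. Thresholds are not
  stored, as the format is only used for unit thresholds.
\<close>

definition represents :: "(nat, nat) activation_instance \<Rightarrow> store \<Rightarrow> bool" where
  "represents I s \<longleftrightarrow>
     verts I = {..<s 0 0} \<and> edges I = {..<s 0 1} \<and>
     (\<forall>e\<in>edges I. ends I e = {s 1 e, s 2 e}) \<and>
     (\<forall>v\<in>verts I. s 3 v = (if v \<in> terminals I then 1 else 0)) \<and>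
     (\<forall>i. 2 \<le> i \<longrightarrow> s 0 i = 0) \<and>
     (\<forall>e. e \<notin> edges I \<longrightarrow> s 1 e = 0 \<and> s 2 e = 0) \<and>
     (\<forall>v. v \<notin> verts I \<longrightarrow> s 3 v = 0) \<and>
     (\<forall>x i. 4 \<le> x \<longrightarrow> s x i = 0)"

text \<open>
  Output format: \<open>a v\<close> is cell \<open>v\<close> of array 4. Integral assignments suffice for unit
  thresholds; the optimum is still taken over all real assignments.
\<close>

definition output_assignment :: "store \<Rightarrow> nat \<Rightarrow> real" where
  "output_assignment s v = real (s 4 v)"

end

theory Submission
  imports Defs
begin

text \<open>
  In an optimal assignment all terminals get value 1, which covers every terminal with a loop or a
  terminal neighbour. Each remaining terminal (an \<^emph>\<open>element\<close>) has to be assigned to a nonterminal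
  neighbour of value 1, and the cost is the number of terminals plus the number of used
  nonterminals. So the task is unweighted set cover in which the number of elements is added to
  the objective.

  The algorithm is a local search over assignments \<open>\<sigma>\<close> of the elements. It minimizes the sum of a
  concave function \<open>pot\<close> of the sizes of the fibers of \<open>\<sigma>\<close> (the \<^emph>\<open>parts\<close>), and it reassigns at
  most \<open>q\<close> elements at once, for a huge constant \<open>q\<close>.

  Let \<open>\<tau>\<close> be an optimal assignment with fibers called \<^emph>\<open>blocks\<close>. Moving a set \<open>X\<close> of elements to
  their blocks gains \<open>gain X\<close> on the parts, a supermodular function, and costs \<open>cost X\<close> on the
  blocks, a submodular one. By uncrossing, the inequality \<open>gain X \<le> cost X\<close> for small sets extends
  to multisets. Hence \<open>U n e\<close>, the best net gain of a move of at most \<open>n\<close> elements that includes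
  \<open>e\<close> and is not charged for \<open>e\<close> itself, obeys the inequalities that a dual solution obeys on a tree:
  the sum of \<open>U n\<close> over a subset of a block is at most the potential of that subset, and the value
  of \<open>U (6 + 30 * n)\<close> at one element of a part is bounded below by the values of \<open>U n\<close> and the
  slacks \<open>gap n\<close> at the others. As \<open>U\<close> is bounded, along a sequence of 300 growing radii there is one at
  which \<open>U\<close> is almost stationary. There the number of parts can be charged to the blocks, and a
  finite check of the possible size profiles of a block bounds the charge of each block.
\<close>

subsection \<open>The potential\<close>

text \<open>
  The six values were found by numerical search. They are nearly equal, so that seven elements of
  one block cannot all lie in parts of size at most six: moving them together would gain at least
  \<open>7 * 71\<close>, more than the cost \<open>pot 7 = 495\<close>.
\<close>

definition marg :: "nat \<Rightarrow> nat" where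
  "marg i = (if i < 6 then [110, 85, 80, 76, 73, 71] ! i else 0)"

definition pot :: "nat \<Rightarrow> nat" where
  "pot n = (\<Sum>i<n. marg i)"

lemma marg_simps [simp]:
  "marg 0 = 110" "marg (Suc 0) = 85" "marg 2 = 80" "marg 3 = 76" "marg 4 = 73" "marg 5 = 71"
  by (simp_all add: marg_def)

lemma marg_eq_0 [simp]: "6 \<le> i \<Longrightarrow> marg i = 0"
  by (simp add: marg_def)

lemma less_6_cases: "i < (6::nat) \<Longrightarrow> i = 0 \<or> i = 1 \<or> i = 2 \<or> i = 3 \<or> i = 4 \<or> i = 5"
  by auto

lemma marg_antimono:
  assumes "i \<le> j"
  shows "marg j \<le> marg i"
proof (rule lift_Suc_antimono_le[OF _ assms])
  show "marg (Suc n) \<le> marg n" for n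
  proof (cases "n < 6")
    case True
    then show ?thesis by (auto dest!: less_6_cases simp: marg_def)
  qed simp
qed

lemma marg_lower: "i < 6 \<Longrightarrow> 71 \<le> marg i"
  using marg_antimono[of i 5] by simp

lemma pot_0 [simp]: "pot 0 = 0" and pot_Suc: "pot (Suc n) = pot n + marg n"
  by (simp_all add: pot_def)

lemma pot_simps [simp]:
  "pot (Suc 0) = 110" "pot 2 = 195" "pot 3 = 275" "pot 4 = 351" "pot 5 = 424" "pot 6 = 495"
  by (simp_all add: pot_def numeral_eq_Suc marg_def)

lemma pot_ge_6: "6 \<le> n \<Longrightarrow> pot n = 495"
  by (induction n rule: dec_induct) (simp_all add: pot_Suc)

lemma pot_diminishing: "x \<le> y \<Longrightarrow> pot (y + k) + pot x \<le> pot y + pot (x + k)"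
proof (induction k)
  case (Suc k)
  then show ?case using marg_antimono[of "x + k" "y + k"] by (simp add: pot_Suc)
qed simp

lemma pot_subadditive: "pot (a + b) \<le> pot a + pot b"
  using pot_diminishing[of 0 a b] by simp

text \<open>With \<open>b = card (B - A)\<close>, the union enlarges \<open>A\<close> by
  \<open>b\<close> elements, and \<open>B\<close> enlarges the intersection by \<open>b\<close>. So
  this is concavity of \<open>pot\<close>.\<close>

lemma pot_submodular:
  assumes "finite A" "finite B"
  shows "pot (card (A \<union> B)) + pot (card (A \<inter> B)) \<le> pot (card A) + pot (card B)"
proof -
  define b where "b = card (B - A)"
  have "card (A \<union> B) = card A + b"
    unfolding b_def by (metis Un_Diff_cancel assms card_Un_disjoint Diff_disjoint finite_Diff)
  moreover have "card B = card (A \<inter> B) + b"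
    unfolding b_def using assms
    by (metis Int_commute card_Diff_subset_Int card_mono finite_Int inf_le1 le_add_diff_inverse)
  moreover have "card (A \<inter> B) \<le> card A"
    using assms by (simp add: card_mono)
  ultimately show ?thesis
    using pot_diminishing[of "card (A \<inter> B)" "card A" b] by simp
qed

subsection \<open>Uncrossing\<close>

text \<open>A multiset with multiplicity function \<open>m\<close> is represented by the decreasing
  chain of its level sets. If \<open>F {} = 0\<close>, the sum of \<open>F\<close> over the levels
  is the Lovasz extension of \<open>F\<close> at \<open>m\<close>.\<close>

definition level :: "('a \<Rightarrow> nat) \<Rightarrow> nat \<Rightarrow> 'a set" where
  "level m j = {x. j < m x}"

definition supermodular :: "('a set \<Rightarrow> int) \<Rightarrow> bool" where
  "supermodular F \<longleftrightarrow>
     (\<forall>A B. finite A \<longrightarrow> finite B \<longrightarrow> F A + F B \<le> F (A \<union> B) + F (A \<inter> B))"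

lemma supermodularD:
  "supermodular F \<Longrightarrow> finite A \<Longrightarrow> finite B \<Longrightarrow> F A + F B \<le> F (A \<union> B) + F (A \<inter> B)"
  by (simp add: supermodular_def)

text \<open>\<open>A\<close> is pushed through the chain. At level \<open>j\<close> the incoming set
  \<open>C j\<close> and the level are replaced by their union, which stays there, and their
  intersection, which goes on to level \<open>j + 1\<close>. By supermodularity the sum does not
  decrease.\<close>

lemma uncross_set:
  assumes F: "supermodular F" and A: "finite A" and m: "finite {x. 0 < m x}" "\<And>x. m x \<le> n"
  shows "F A + (\<Sum>j<n. F (level m j)) \<le> (\<Sum>j<Suc n. F (level (\<lambda>x. m x + of_bool (x \<in> A)) j))"
proof -
  define C where "C j = (if j = 0 then A else A \<inter> level m (j - 1))" for j
  have fin: "finite (level m j)" for j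
    by (rule finite_subset[OF _ m(1)]) (auto simp: level_def)
  have lev: "level (\<lambda>x. m x + of_bool (x \<in> A)) j = level m j \<union> C j" for j
    by (cases j) (auto simp: level_def C_def of_bool_def)
  have step: "F (level m j) + F (C j) \<le> F (level m j \<union> C j) + F (C (Suc j))" for j
  proof -
    have "level m j \<inter> C j = C (Suc j)"
      by (auto simp: level_def C_def)
    then show ?thesis
      using supermodularD[OF F fin[of j], of "C j"] A fin by (simp add: C_def)
  qed
  have "F A + (\<Sum>j<k. F (level m j)) \<le> (\<Sum>j<k. F (level m j \<union> C j)) + F (C k)" for k
  proof (induction k)
    case 0
    then show ?case by (simp add: C_def)
  next
    case (Suc k)
    then show ?case using step[of k] by simp
  qed
  from this[of n] have "F A + (\<Sum>j<n. F (level m j)) \<le> (\<Sum>j<n. F (level m j \<union> C j)) + F (C n)" .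
  \<comment> \<open>Beyond the chain only the remainder \<open>C n\<close> is left; it becomes the
    new last level.\<close>
  moreover have "level m n = {}"
    using m(2) by (auto simp: level_def not_less)
  ultimately show ?thesis
    by (simp add: lev)
qed

text \<open>After uncrossing, a family matters only through its total multiplicities. So a family on
  the gain side and another one on the cost side can be compared as soon as their multiplicities
  agree.\<close>

lemma uncross_family:
  assumes F: "supermodular F" and I: "finite I" "\<And>i. i \<in> I \<Longrightarrow> finite (S i)"
    and m: "finite {x. 0 < m x}" "\<And>x. m x \<le> n"
  shows "(\<Sum>i\<in>I. F (S i)) + (\<Sum>j<n. F (level m j)) \<le>
     (\<Sum>j<n + card I. F (level (\<lambda>x. m x + (\<Sum>i\<in>I. of_bool (x \<in> S i))) j))"
  using I
proof (induction I rule: finite_induct)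
  case (insert a I)
  let ?m = "\<lambda>x. m x + (\<Sum>i\<in>I. of_bool (x \<in> S i))"
  have "{x. 0 < ?m x} \<subseteq> {x. 0 < m x} \<union> (\<Union>i\<in>I. S i)"
    using insert.hyps(1) by (auto simp: card_gt_0_iff)
  then have fin: "finite {x. 0 < ?m x}"
    by (rule finite_subset) (use m insert in auto)
  have le: "?m x \<le> n + card I" for x
  proof -
    have "(\<Sum>i\<in>I. of_bool (x \<in> S i)) \<le> (\<Sum>i\<in>I. (1::nat))"
      by (rule sum_mono) simp
    then show ?thesis using m(2)[of x] by simp
  qed
  have "F (S a) + (\<Sum>j<n + card I. F (level ?m j)) \<le>
      (\<Sum>j<Suc (n + card I). F (level (\<lambda>x. ?m x + of_bool (x \<in> S a)) j))"
    by (rule uncross_set[OF F _ fin le]) (use insert in auto)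
  moreover have "(\<lambda>x. ?m x + of_bool (x \<in> S a)) =
      (\<lambda>x. m x + (\<Sum>i\<in>insert a I. of_bool (x \<in> S i)))"
    using insert.hyps by (simp add: fun_eq_iff)
  ultimately show ?case
    using insert by (simp del: sum.lessThan_Suc)
qed simp

lemma sum_level_extend:
  assumes "F {} = (0::int)" "\<And>x. m x \<le> n" "n \<le> n'"
  shows "(\<Sum>j<n'. F (level m j)) = (\<Sum>j<n. F (level m j))"
proof -
  have "level m j = {}" if "n \<le> j" for j
    using assms(2) that by (auto simp: level_def not_less intro: order_trans)
  then show ?thesis
    using assms(1,3) by (intro sum.mono_neutral_right) auto
qed


subsection \<open>Local optima\<close>

definition fiber :: "'a set \<Rightarrow> ('a \<Rightarrow> 'b) \<Rightarrow> 'b \<Rightarrow> 'a set" where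
  "fiber E \<sigma> v = {e \<in> E. \<sigma> e = v}"

definition gain :: "'a set \<Rightarrow> 'b set \<Rightarrow> ('a \<Rightarrow> 'b) \<Rightarrow> 'a set \<Rightarrow> int" where
  "gain E V \<sigma> X = (\<Sum>v\<in>V. int (pot (card (fiber E \<sigma> v))) - int (pot (card (fiber E \<sigma> v - X))))"

text \<open>The moved elements are priced as if they formed parts of their own, whatever already
  sits at their new place. Subadditivity of \<open>pot\<close> makes this an upper bound for the
  true increase, see \<open>exchange_le\<close>.\<close>

definition cost :: "'a set \<Rightarrow> 'b set \<Rightarrow> ('a \<Rightarrow> 'b) \<Rightarrow> 'a set \<Rightarrow> int" where
  "cost E V \<tau> X = (\<Sum>v\<in>V. int (pot (card (fiber E \<tau> v \<inter> X))))"

text \<open>Complements turn unions into intersections, and the residual potential enters with a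
  minus sign; so submodularity of \<open>pot\<close> on the residual sets becomes
  supermodularity.\<close>

lemma gain_supermodular:
  assumes "finite E"
  shows "supermodular (gain E V \<sigma>)"
  unfolding supermodular_def
proof (intro allI impI)
  fix A B :: "'a set"
  have "pot (card (fiber E \<sigma> v - (A \<union> B))) + pot (card (fiber E \<sigma> v - (A \<inter> B)))
      \<le> pot (card (fiber E \<sigma> v - A)) + pot (card (fiber E \<sigma> v - B))" for v
  proof -
    have fin: "finite (fiber E \<sigma> v - Y)" for Y
      using assms by (simp add: fiber_def)
    have "fiber E \<sigma> v - (A \<union> B) = (fiber E \<sigma> v - A) \<inter> (fiber E \<sigma> v - B)"
      "fiber E \<sigma> v - (A \<inter> B) = (fiber E \<sigma> v - A) \<union> (fiber E \<sigma> v - B)"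
      by auto
    then show ?thesis
      using pot_submodular[OF fin[of A] fin[of B]] by simp
  qed
  then have "int (pot (card (fiber E \<sigma> v - (A \<union> B)))) + int (pot (card (fiber E \<sigma> v - (A \<inter> B))))
      \<le> int (pot (card (fiber E \<sigma> v - A))) + int (pot (card (fiber E \<sigma> v - B)))" for v
    unfolding of_nat_add[symmetric] of_nat_le_iff .
  then show "gain E V \<sigma> A + gain E V \<sigma> B \<le> gain E V \<sigma> (A \<union> B) + gain E V \<sigma> (A \<inter> B)"
    unfolding gain_def sum.distrib[symmetric]
    by (intro sum_mono) (simp add: algebra_simps)
qed

lemma cost_submodular: "supermodular (\<lambda>X. - cost E V \<tau> X)"
  unfolding supermodular_def
proof (intro allI impI)
  fix A B :: "'a set"
  assume fin: "finite A" "finite B"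
  have "pot (card (fiber E \<tau> v \<inter> (A \<union> B))) + pot (card (fiber E \<tau> v \<inter> (A \<inter> B)))
      \<le> pot (card (fiber E \<tau> v \<inter> A)) + pot (card (fiber E \<tau> v \<inter> B))" for v
  proof -
    have "fiber E \<tau> v \<inter> (A \<union> B) = (fiber E \<tau> v \<inter> A) \<union> (fiber E \<tau> v \<inter> B)"
      "fiber E \<tau> v \<inter> (A \<inter> B) = (fiber E \<tau> v \<inter> A) \<inter> (fiber E \<tau> v \<inter> B)"
      by auto
    then show ?thesis
      using pot_submodular[of "fiber E \<tau> v \<inter> A" "fiber E \<tau> v \<inter> B"] fin by simp
  qed
  then have "int (pot (card (fiber E \<tau> v \<inter> (A \<union> B)))) + int (pot (card (fiber E \<tau> v \<inter> (A \<inter> B))))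
      \<le> int (pot (card (fiber E \<tau> v \<inter> A))) + int (pot (card (fiber E \<tau> v \<inter> B)))" for v
    unfolding of_nat_add[symmetric] of_nat_le_iff .
  then have "cost E V \<tau> (A \<union> B) + cost E V \<tau> (A \<inter> B) \<le> cost E V \<tau> A + cost E V \<tau> B"
    unfolding cost_def sum.distrib[symmetric] by (intro sum_mono)
  then show "- cost E V \<tau> A + - cost E V \<tau> B \<le> - cost E V \<tau> (A \<union> B) + - cost E V \<tau> (A \<inter> B)"
    by linarith
qed

lemma gain_empty [simp]: "gain E V \<sigma> {} = 0" and cost_empty [simp]: "cost E V \<tau> {} = 0"
  by (simp_all add: gain_def cost_def)

lemma cost_within_fiber:
  assumes "finite V" "v \<in> V" "Y \<subseteq> fiber E \<tau> v"
  shows "cost E V \<tau> Y = int (pot (card Y))"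
proof -
  have "cost E V \<tau> Y = (\<Sum>u\<in>V. if u = v then int (pot (card Y)) else 0)"
    unfolding cost_def
  proof (rule sum.cong[OF refl])
    fix u
    have "fiber E \<tau> u \<inter> Y = (if u = v then Y else {})"
      using assms(3) by (auto simp: fiber_def)
    then show "int (pot (card (fiber E \<tau> u \<inter> Y))) = (if u = v then int (pot (card Y)) else 0)"
      by simp
  qed
  then show ?thesis using assms by simp
qed

lemma gain_within_fiber:
  assumes "finite V" "v \<in> V" "Y \<subseteq> fiber E \<sigma> v"
  shows "gain E V \<sigma> Y = int (pot (card (fiber E \<sigma> v))) - int (pot (card (fiber E \<sigma> v - Y)))"
proof -
  have "gain E V \<sigma> Y = (\<Sum>u\<in>V. if u = v
      then int (pot (card (fiber E \<sigma> v))) - int (pot (card (fiber E \<sigma> v - Y))) else 0)"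
    unfolding gain_def
  proof (rule sum.cong[OF refl])
    fix u
    have "fiber E \<sigma> u - Y = fiber E \<sigma> u" if "u \<noteq> v"
      using assms(3) that by (auto simp: fiber_def)
    then show "int (pot (card (fiber E \<sigma> u))) - int (pot (card (fiber E \<sigma> u - Y))) =
      (if u = v then int (pot (card (fiber E \<sigma> v))) - int (pot (card (fiber E \<sigma> v - Y))) else 0)"
      by simp
  qed
  then show ?thesis using assms by simp
qed

locale local_optimum =
  fixes E :: "'a set" and V :: "'b set" and \<sigma> \<tau> :: "'a \<Rightarrow> 'b" and q :: nat
  assumes fin_E: "finite E" and fin_V: "finite V"
    and \<sigma>_V: "\<And>e. e \<in> E \<Longrightarrow> \<sigma> e \<in> V" and \<tau>_V: "\<And>e. e \<in> E \<Longrightarrow> \<tau> e \<in> V"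
    and optimal: "\<And>X. X \<subseteq> E \<Longrightarrow> card X \<le> q \<Longrightarrow> gain E V \<sigma> X \<le> cost E V \<tau> X"
begin

abbreviation "part \<equiv> fiber E \<sigma>"
abbreviation "block \<equiv> fiber E \<tau>"
abbreviation "H \<equiv> gain E V \<sigma>"
abbreviation "C \<equiv> cost E V \<tau>"

definition size :: "'a \<Rightarrow> nat" where "size e = card (part (\<sigma> e))"

text \<open>Parts of size at least 7 carry no charge, since \<open>80820 - 12480 * s\<close> is
  negative for them (see \<open>part_value\<close>). All exchange arguments are confined to the
  remaining elements.\<close>

definition Act :: "'a set" where "Act = {e \<in> E. size e \<le> 6}"

text \<open>
  The move \<open>X\<close> is not charged for \<open>e\<close>. In a tree of moves this is the value that the subtree on the
  part side of \<open>e\<close> contributes to the block of \<open>e\<close>.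
\<close>

definition U :: "nat \<Rightarrow> 'a \<Rightarrow> int" where
  "U n e = Max ((\<lambda>X. H X - C (X - {e})) ` {X. X \<subseteq> Act \<and> e \<in> X \<and> card X \<le> n})"

lemma Act_E: "Act \<subseteq> E" and fin_Act: "finite Act"
  using fin_E by (auto simp: Act_def)

lemma size_pos: "e \<in> E \<Longrightarrow> 1 \<le> size e"
  using fin_E by (auto simp: size_def fiber_def card_gt_0_iff Suc_le_eq)

lemma fin_candidates: "finite {X. X \<subseteq> Act \<and> e \<in> X \<and> card X \<le> n}"
  by (rule finite_subset[of _ "Pow Act"]) (auto simp: fin_Act)

lemma U_ge: "X \<subseteq> Act \<Longrightarrow> e \<in> X \<Longrightarrow> card X \<le> n \<Longrightarrow> H X - C (X - {e}) \<le> U n e"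
  unfolding U_def using fin_candidates by (intro Max_ge) auto

lemma U_attained:
  assumes "e \<in> Act" "1 \<le> n"
  obtains X where "X \<subseteq> Act" "e \<in> X" "card X \<le> n" "U n e = H X - C (X - {e})"
proof -
  let ?S = "{X. X \<subseteq> Act \<and> e \<in> X \<and> card X \<le> n}"
  have "{e} \<in> ?S"
    using assms by auto
  then have "U n e \<in> (\<lambda>X. H X - C (X - {e})) ` ?S"
    unfolding U_def using fin_candidates by (intro Max_in) auto
  then show ?thesis using that by auto
qed

lemma U_mono: "e \<in> Act \<Longrightarrow> 1 \<le> n \<Longrightarrow> n \<le> n' \<Longrightarrow> U n e \<le> U n' e"
  by (rule U_attained[of e n]) (auto intro: U_ge)

lemma U_lower:
  assumes "e \<in> Act" "1 \<le> n"
  shows "int (marg (size e - 1)) \<le> U n e"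
proof -
  have e: "e \<in> E" using assms Act_E by auto
  have "e \<in> part (\<sigma> e)" "finite (part (\<sigma> e))"
    using e fin_E by (auto simp: fiber_def)
  then have "card (part (\<sigma> e) - {e}) = size e - 1"
    by (simp add: size_def)
  then have "H {e} = int (pot (size e)) - int (pot (size e - 1))"
    using gain_within_fiber[OF fin_V \<sigma>_V[OF e], of "{e}" E \<sigma>] \<open>e \<in> part (\<sigma> e)\<close>
    by (simp add: size_def)
  also have "\<dots> = int (marg (size e - 1))"
    using size_pos[OF e] pot_Suc[of "size e - 1"] by simp
  finally show ?thesis
    using U_ge[of "{e}" e n] assms by simp
qed

section \<open>Exchange inequalities for multisets of moved elements\<close>

lemma level_subset_support: "level m j \<subseteq> {x. 0 < m x}"
  by (auto simp: level_def)

text \<open>Gain and cost are taken at the same multiset. Each of its levels is a set of at most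
  \<open>q\<close> elements, so local optimality applies level by level; surplus levels are
  empty.\<close>

lemma exchange_closed:
  assumes h: "h \<le> (\<Sum>j<n. H (level m j))" and c: "(\<Sum>j<n'. C (level m j)) \<le> c"
    and le: "\<And>x. m x \<le> n" "\<And>x. m x \<le> n'"
    and supp: "{x. 0 < m x} \<subseteq> Act" "card {x. 0 < m x} \<le> q"
  shows "h \<le> c"
proof -
  let ?N = "n + n'"
  have "level m j \<subseteq> E \<and> card (level m j) \<le> q" for j
    using level_subset_support[of m j] supp Act_E
    by (meson card_mono fin_Act finite_subset order_trans)
  then have "(\<Sum>j<?N. H (level m j)) \<le> (\<Sum>j<?N. C (level m j))"
    by (intro sum_mono optimal) auto
  moreover have "(\<Sum>j<?N. H (level m j)) = (\<Sum>j<n. H (level m j))"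
    by (rule sum_level_extend) (use le in auto)
  moreover have "(\<Sum>j<?N. C (level m j)) = (\<Sum>j<n'. C (level m j))"
    by (rule sum_level_extend) (use le in auto)
  ultimately show ?thesis using h c by linarith
qed

text \<open>The gain side has one copy of \<open>e0\<close> more than the cost side, so the two
  chains differ only at level \<open>m' e0\<close>. That level, not charged for \<open>e0\<close>,
  is a candidate in \<open>U k e0\<close>; at every other level the net gain is at most 0.\<close>

lemma exchange_open:
  assumes h: "h \<le> (\<Sum>j<n. H (level m j))" and c: "(\<Sum>j<n'. C (level m' j)) \<le> c"
    and le: "\<And>x. m x \<le> n" "\<And>x. m' x \<le> n'"
    and eq: "\<And>x. m x = m' x + of_bool (x = e0)"
    and supp: "{x. 0 < m x} \<subseteq> Act" "card {x. 0 < m x} \<le> k" "k \<le> q"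
  shows "h - c \<le> U k e0"
proof -
  let ?N = "n + n'" and ?r = "m' e0"
  have sub: "level m j \<subseteq> Act \<and> card (level m j) \<le> k" for j
    using level_subset_support[of m j] supp by (meson card_mono fin_Act finite_subset order_trans)
  have same: "level m' j = level m j" if "j \<noteq> ?r" for j
    using that by (auto simp: level_def eq of_bool_def split: if_splits)
  have special: "level m' ?r = level m ?r - {e0}" "e0 \<in> level m ?r"
    by (auto simp: level_def eq of_bool_def split: if_splits)
  have "?r < ?N"
    using le(1)[of e0] by (simp add: eq)
  have "h - c \<le> (\<Sum>j<?N. H (level m j)) - (\<Sum>j<?N. C (level m' j))"
    using h c sum_level_extend[of H m n ?N] sum_level_extend[of C m' n' ?N] le by simp
  also have "\<dots> = (\<Sum>j<?N. H (level m j) - C (level m' j))"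
    by (simp add: sum_subtractf)
  also have "\<dots> \<le> (\<Sum>j<?N. if j = ?r then H (level m ?r) - C (level m ?r - {e0}) else 0)"
  proof (rule sum_mono)
    fix j
    have "H (level m j) - C (level m j) \<le> 0"
      using optimal[of "level m j"] sub[of j] Act_E supp(3) by force
    then show "H (level m j) - C (level m' j) \<le>
        (if j = ?r then H (level m ?r) - C (level m ?r - {e0}) else 0)"
      using same[of j] special by simp
  qed
  also have "\<dots> = H (level m ?r) - C (level m ?r - {e0})"
    using \<open>?r < ?N\<close> by simp
  also have "\<dots> \<le> U k e0"
    using sub special(2) by (intro U_ge) auto
  finally show ?thesis .
qed

lemma card_Union_bound:
  assumes "finite I" "\<And>i. i \<in> I \<Longrightarrow> card (S i) \<le> n"
  shows "card (\<Union>i\<in>I. S i) \<le> card I * n"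
  using card_UN_le[OF assms(1), of S] sum_bounded_above[of I "\<lambda>i. card (S i)" n] assms by simp

lemma of_bool_split: "e \<in> S \<Longrightarrow> of_bool (x \<in> S) = of_bool (x \<in> S - {e}) + (of_bool (x = e) :: nat)"
  by auto

lemma sum_indicator_eq: "finite S \<Longrightarrow> (\<Sum>e\<in>S. of_bool (x = e)) = (of_bool (x \<in> S) :: nat)"
  by (auto simp: of_bool_def sum.delta' if_distrib cong: if_cong)

lemma sum_indicator_le: "(\<Sum>i\<in>K. of_bool (x \<in> S i)) \<le> card K"
  using sum_bounded_above[of K "\<lambda>i. of_bool (x \<in> S i)" "1::nat"] by simp

lemma level_indicator: "(\<Sum>j<1. F (level (\<lambda>x. of_bool (x \<in> A)) j)) = F A"
  by (simp add: level_def)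

lemma U_attaining_family:
  assumes "Y \<subseteq> Act" "1 \<le> n"
  shows "\<exists>X. \<forall>e\<in>Y. X e \<subseteq> Act \<and> e \<in> X e \<and> card (X e) \<le> n \<and> U n e = H (X e) - C (X e - {e})"
proof (intro bchoice ballI)
  fix e assume "e \<in> Y"
  with assms have "e \<in> Act" by auto
  then show "\<exists>X. X \<subseteq> Act \<and> e \<in> X \<and> card X \<le> n \<and> U n e = H X - C (X - {e})"
    by (rule U_attained[OF _ assms(2)]) blast
qed

text \<open>Optimal moves \<open>X e\<close> for all \<open>e\<close> in \<open>Y\<close> are
  combined. None is charged for its own \<open>e\<close>, and \<open>Y\<close> itself, at the price
  \<open>pot (card Y)\<close>, supplies exactly the missing charges. So the gain and cost multisets
  agree.\<close>

lemma sum_U_le: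
  assumes Y: "Y \<subseteq> Act" "Y \<subseteq> block v" and n: "1 \<le> n" "card Y * n \<le> q"
  shows "(\<Sum>e\<in>Y. U n e) \<le> int (pot (card Y))"
proof (cases "Y = {}")
  case False
  then have "v \<in> V"
    using Y \<tau>_V by (auto simp: fiber_def)
  have fin: "finite Y"
    using Y fin_Act finite_subset by blast
  obtain X where X: "\<And>e. e \<in> Y \<Longrightarrow> X e \<subseteq> Act \<and> e \<in> X e \<and> card (X e) \<le> n \<and>
      U n e = H (X e) - C (X e - {e})"
    using U_attaining_family[OF Y(1) n(1)] by blast
  have finX: "finite (X e)" if "e \<in> Y" for e
    using X[OF that] fin_Act finite_subset by blast
  define m :: "'a \<Rightarrow> nat" where "m x = (\<Sum>e\<in>Y. of_bool (x \<in> X e))" for x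
  have m_eq: "m x = of_bool (x \<in> Y) + (\<Sum>e\<in>Y. of_bool (x \<in> X e - {e}))" for x :: 'a
  proof -
    have "m x = (\<Sum>e\<in>Y. of_bool (x \<in> X e - {e}) + of_bool (x = e))"
      unfolding m_def using X by (intro sum.cong[OF refl] of_bool_split) auto
    then show ?thesis
      unfolding sum.distrib sum_indicator_eq[OF fin] by (rule trans[OF _ add.commute])
  qed
  have le: "m x \<le> card Y" for x
  proof -
    have "m x \<le> (\<Sum>e\<in>Y. 1)"
      unfolding m_def by (rule sum_mono) simp
    then show ?thesis by simp
  qed
  have supp: "{x. 0 < m x} \<subseteq> (\<Union>e\<in>Y. X e)"
    using fin by (auto simp: m_def card_gt_0_iff)
  have "(\<Sum>e\<in>Y. H (X e)) \<le> (\<Sum>j<card Y. H (level m j))"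
  proof -
    have "(\<Sum>e\<in>Y. H (X e)) + (\<Sum>j<0. H (level (\<lambda>_. 0) j)) \<le>
        (\<Sum>j<0 + card Y. H (level (\<lambda>x. 0 + (\<Sum>e\<in>Y. of_bool (x \<in> X e))) j))"
      by (rule uncross_family[OF gain_supermodular[OF fin_E] fin]) (use finX in auto)
    then show ?thesis
      unfolding add_0 m_def[abs_def, symmetric] by simp
  qed
  moreover have "(\<Sum>e\<in>Y. - C (X e - {e})) + (\<Sum>j<1. - C (level (\<lambda>x. of_bool (x \<in> Y)) j)) \<le>
      (\<Sum>j<1 + card Y. - C (level (\<lambda>x. of_bool (x \<in> Y) + (\<Sum>e\<in>Y. of_bool (x \<in> X e - {e}))) j))"
    by (rule uncross_family[OF cost_submodular fin]) (use finX fin in \<open>auto simp: of_bool_def\<close>)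
  then have "(\<Sum>j<1 + card Y. C (level m j)) \<le> int (pot (card Y)) + (\<Sum>e\<in>Y. C (X e - {e}))"
    unfolding level_indicator[of "\<lambda>X. - C X"] m_eq[abs_def, symmetric]
    by (simp add: sum_negf cost_within_fiber[OF fin_V \<open>v \<in> V\<close> Y(2)] del: sum.lessThan_Suc)
  ultimately have "(\<Sum>e\<in>Y. H (X e)) \<le> int (pot (card Y)) + (\<Sum>e\<in>Y. C (X e - {e}))"
  proof (rule exchange_closed)
    show "m x \<le> card Y" "m x \<le> 1 + card Y" for x
      using le[of x] by auto
    show "{x. 0 < m x} \<subseteq> Act"
      using supp X by blast
    have "card {x. 0 < m x} \<le> card (\<Union>e\<in>Y. X e)"
      by (rule card_mono[OF _ supp]) (use fin finX in auto)
    also have "\<dots> \<le> card Y * n"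
      by (rule card_Union_bound[OF fin]) (use X in auto)
    finally show "card {x. 0 < m x} \<le> q"
      using n by linarith
  qed
  then show ?thesis
    using X by (simp add: sum_subtractf)
qed simp

text \<open>The part is emptied, which gains its full potential. Each \<open>e\<close> other than
  \<open>e0\<close> is placed in its block together with \<open>Y e\<close>, and every other member
  \<open>e'\<close> of \<open>Y e\<close> brings an optimal move that is not charged for
  \<open>e'\<close>. Only the charge for \<open>e0\<close> is then missing, so the combined move
  bounds \<open>U\<close> at \<open>e0\<close> from below.\<close>

lemma part_le_U:
  assumes P: "card (part v) \<le> 6" and e0: "e0 \<in> part v"
    and Y: "\<And>e. e \<in> part v \<Longrightarrow> e \<in> Y e \<and> Y e \<subseteq> Act \<and> Y e \<subseteq> block (\<tau> e) \<and> card (Y e) \<le> 6"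
    and n: "1 \<le> n" "6 + 30 * n \<le> q"
  shows "int (pot (card (part v))) +
      (\<Sum>e\<in>part v - {e0}. (\<Sum>e'\<in>Y e - {e}. U n e') - int (pot (card (Y e)))) \<le> U (6 + 30 * n) e0"
proof -
  let ?P = "part v" and ?Q = "part v - {e0}"
  have v: "v \<in> V"
    using e0 \<sigma>_V by (auto simp: fiber_def)
  have finP: "finite ?P" "finite ?Q"
    using fin_E by (auto simp: fiber_def)
  have P_E: "?P \<subseteq> E"
    by (auto simp: fiber_def)
  have P_Act: "?P \<subseteq> Act"
    using P by (auto simp: Act_def size_def fiber_def)
  have finY: "finite (Y e)" if "e \<in> ?P" for e
    using Y[OF that] fin_Act finite_subset by blast
  obtain X where X: "\<And>e. e \<in> Act \<Longrightarrow> X e \<subseteq> Act \<and> e \<in> X e \<and> card (X e) \<le> n \<and>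
      U n e = H (X e) - C (X e - {e})"
    using U_attaining_family[OF subset_refl n(1)] by blast
  \<comment> \<open>Pairs are used because the same \<open>e'\<close> may occur in
    \<open>Y e\<close> for several \<open>e\<close>; its move is then taken once for each.\<close>
  define I where "I = Sigma ?Q (\<lambda>e. Y e - {e})"
  have finI: "finite I"
    unfolding I_def using finP finY by auto
  have I: "snd i \<in> Act" if "i \<in> I" for i
    using that Y[of "fst i"] by (auto simp: I_def)
  have finX: "finite (X (snd i))" if "i \<in> I" for i
    using X[OF I[OF that]] fin_Act finite_subset by blast
  define mY :: "'a \<Rightarrow> nat" where "mY x = (\<Sum>e\<in>?Q. of_bool (x \<in> Y e))" for x
  define m' :: "'a \<Rightarrow> nat" where
    "m' x = mY x + (\<Sum>i\<in>I. of_bool (x \<in> X (snd i) - {snd i}))" for x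
  define m :: "'a \<Rightarrow> nat" where
    "m x = of_bool (x \<in> ?P) + (\<Sum>i\<in>I. of_bool (x \<in> X (snd i)))" for x
  have m_eq: "m x = m' x + of_bool (x = e0)" for x
  proof -
    have "(\<Sum>i\<in>I. of_bool (x \<in> X (snd i))) =
        (\<Sum>i\<in>I. of_bool (x \<in> X (snd i) - {snd i}) + (of_bool (x = snd i) :: nat))"
      using I X by (intro sum.cong[OF refl] of_bool_split) auto
    also have "\<dots> = (\<Sum>i\<in>I. of_bool (x \<in> X (snd i) - {snd i})) + (\<Sum>i\<in>I. of_bool (x = snd i))"
      by (rule sum.distrib)
    also have "(\<Sum>i\<in>I. of_bool (x = snd i)) = (\<Sum>e\<in>?Q. \<Sum>e'\<in>Y e - {e}. (of_bool (x = e') :: nat))"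
      unfolding I_def using finP finY by (subst sum.Sigma) (auto simp: case_prod_beta)
    also have "\<dots> = (\<Sum>e\<in>?Q. of_bool (x \<in> Y e - {e}))"
      using finY by (intro sum.cong[OF refl] sum_indicator_eq) auto
    finally have 1: "(\<Sum>i\<in>I. of_bool (x \<in> X (snd i))) =
        (\<Sum>i\<in>I. of_bool (x \<in> X (snd i) - {snd i})) + (\<Sum>e\<in>?Q. (of_bool (x \<in> Y e - {e}) :: nat))" .
    have "mY x = (\<Sum>e\<in>?Q. of_bool (x \<in> Y e - {e}) + of_bool (x = e))"
      unfolding mY_def using Y by (intro sum.cong[OF refl] of_bool_split) auto
    also have "\<dots> = (\<Sum>e\<in>?Q. of_bool (x \<in> Y e - {e})) + of_bool (x \<in> ?Q)"
      unfolding sum.distrib sum_indicator_eq[OF finP(2)] ..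
    finally have 2: "mY x = (\<Sum>e\<in>?Q. of_bool (x \<in> Y e - {e})) + of_bool (x \<in> ?Q)" .
    show ?thesis
      unfolding m_def m'_def 1 2 of_bool_split[OF e0] by (rule trans[OF _ sym[OF refl]]) simp
  qed
  have "(\<Sum>i\<in>I. H (X (snd i))) + (\<Sum>j<1. H (level (\<lambda>x. of_bool (x \<in> ?P)) j)) \<le>
      (\<Sum>j<1 + card I. H (level (\<lambda>x. of_bool (x \<in> ?P) + (\<Sum>i\<in>I. of_bool (x \<in> X (snd i)))) j))"
    by (rule uncross_family[OF gain_supermodular[OF fin_E] finI]) (use finX finP in \<open>auto simp: of_bool_def\<close>)
  moreover have "H ?P = int (pot (card ?P))"
    using gain_within_fiber[OF fin_V v, of ?P E \<sigma>] by simp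
  ultimately have h: "(\<Sum>i\<in>I. H (X (snd i))) + int (pot (card ?P)) \<le> (\<Sum>j<1 + card I. H (level m j))"
    unfolding level_indicator m_def[abs_def, symmetric] by (simp del: sum.lessThan_Suc)
  \<comment> \<open>The sets \<open>Y e\<close> are uncrossed first, from the empty multiset; the
    result \<open>mY\<close> is the base to which the charged parts of the moves are added.\<close>
  have "(\<Sum>e\<in>?Q. - C (Y e)) + (\<Sum>j<0. - C (level (\<lambda>_. 0) j)) \<le>
      (\<Sum>j<0 + card ?Q. - C (level (\<lambda>x. 0 + (\<Sum>e\<in>?Q. of_bool (x \<in> Y e))) j))"
    by (rule uncross_family[OF cost_submodular finP(2)]) (use finY in auto)
  then have "(\<Sum>e\<in>?Q. - C (Y e)) \<le> (\<Sum>j<card ?Q. - C (level mY j))"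
    unfolding add_0 mY_def[abs_def, symmetric] by (simp del: sum.lessThan_Suc)
  moreover have "(\<Sum>i\<in>I. - C (X (snd i) - {snd i})) + (\<Sum>j<card ?Q. - C (level mY j)) \<le>
      (\<Sum>j<card ?Q + card I. - C (level (\<lambda>x. mY x + (\<Sum>i\<in>I. of_bool (x \<in> X (snd i) - {snd i}))) j))"
  proof (rule uncross_family[OF cost_submodular finI])
    have "{x. 0 < mY x} \<subseteq> (\<Union>e\<in>?Q. Y e)"
      using finP(2) by (auto simp: mY_def card_gt_0_iff)
    then show "finite {x. 0 < mY x}"
      by (rule finite_subset) (use finP finY in auto)
    show "mY x \<le> card ?Q" for x
      unfolding mY_def by (rule sum_indicator_le)
  qed (use finX in auto)
  ultimately have c: "(\<Sum>j<card ?Q + card I. C (level m' j)) \<le>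
      (\<Sum>e\<in>?Q. C (Y e)) + (\<Sum>i\<in>I. C (X (snd i) - {snd i}))"
    unfolding m'_def[abs_def, symmetric] by (simp add: sum_negf)
  \<comment> \<open>There are at most five elements besides \<open>e0\<close>, each with at most
    five companions in \<open>Y e\<close>.\<close>
  have cI: "card I \<le> 25"
  proof -
    have "card I = (\<Sum>e\<in>?Q. card (Y e - {e}))"
      unfolding I_def using finP finY by (subst card_SigmaI) auto
    also have "\<dots> \<le> of_nat (card ?Q) * 5"
    proof (rule sum_bounded_above)
      fix e assume "e \<in> ?Q"
      then show "card (Y e - {e}) \<le> 5" using Y[of e] by auto
    qed
    also have "card ?Q \<le> 5"
      using P e0 by simp
    finally show ?thesis by simp
  qed
  have "((\<Sum>i\<in>I. H (X (snd i))) + int (pot (card ?P))) -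
      ((\<Sum>e\<in>?Q. C (Y e)) + (\<Sum>i\<in>I. C (X (snd i) - {snd i}))) \<le> U (6 + 30 * n) e0"
  proof (rule exchange_open[OF h c _ _ m_eq _ _ n(2)])
    show "m x \<le> 1 + card I" for x
      unfolding m_def using sum_indicator_le[of x "\<lambda>i. X (snd i)" I] by (intro add_mono) auto
    show "m' x \<le> card ?Q + card I" for x
      unfolding m'_def mY_def by (intro add_mono sum_indicator_le)
    have supp: "{x. 0 < m x} \<subseteq> ?P \<union> (\<Union>i\<in>I. X (snd i))"
      using finI by (auto simp: m_def card_gt_0_iff of_bool_def split: if_splits)
    also have "\<dots> \<subseteq> Act"
      using P_Act X I by blast
    finally show "{x. 0 < m x} \<subseteq> Act" .
    have "card {x. 0 < m x} \<le> card (?P \<union> (\<Union>i\<in>I. X (snd i)))"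
      by (rule card_mono[OF _ supp]) (use finP finI finX in auto)
    also have "\<dots> \<le> card ?P + card (\<Union>i\<in>I. X (snd i))"
      by (rule card_Un_le)
    also have "\<dots> \<le> 6 + card I * n"
      using P X I by (intro add_mono card_Union_bound finI) auto
    also have "\<dots> \<le> 6 + 30 * n"
      using cI by (intro add_mono mult_mono) auto
    finally show "card {x. 0 < m x} \<le> 6 + 30 * n" .
  qed
  moreover have "(\<Sum>e\<in>?Q. C (Y e)) = (\<Sum>e\<in>?Q. int (pot (card (Y e))))"
    using Y P_E \<tau>_V by (intro sum.cong[OF refl] cost_within_fiber[OF fin_V]) auto
  moreover have "(\<Sum>e\<in>?Q. \<Sum>e'\<in>Y e - {e}. U n e') = (\<Sum>i\<in>I. U n (snd i))"
    unfolding I_def using finP finY by (subst sum.Sigma) (auto simp: case_prod_beta)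
  moreover have "(\<Sum>i\<in>I. U n (snd i)) = (\<Sum>i\<in>I. H (X (snd i))) - (\<Sum>i\<in>I. C (X (snd i) - {snd i}))"
    unfolding sum_subtractf[symmetric] using X I by (intro sum.cong[OF refl]) auto
  ultimately show ?thesis
    by (simp add: sum_subtractf)
qed

end

subsection \<open>The charge of a block\<close>

text \<open>
  All charges are scaled by \<open>80820 = 60 * 1347\<close>: an element of a part of size \<open>j\<close> pays its share
  \<open>1 / j\<close> of the part and is refunded \<open>208 / 1347\<close>, which makes \<open>weight j\<close> below. A block
  may be charged up to \<open>80820 * 1555 / 1347 = 93300\<close>.

  The argument \<open>aj\<close> of \<open>admissible\<close> is the number of elements of the block whose part has size
  \<open>j\<close>, and \<open>t\<close> is the slack of the block. The four tests are the bounds that arise from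
  \<open>threshold_bound\<close> for the thresholds 1, 2, 3, 4; it suffices that one of them holds.
\<close>

definition ifpos :: "int \<Rightarrow> int \<Rightarrow> int" where
  "ifpos a c = (if 0 < a then c else 0)"

lemma ifpos_pos [simp]: "0 < a \<Longrightarrow> ifpos a c = c"
  by (simp add: ifpos_def)

lemma ifpos_nonneg [simp]: "0 \<le> c \<Longrightarrow> 0 \<le> ifpos a c"
  by (simp add: ifpos_def)

definition pot_table :: "int \<Rightarrow> int" where
  "pot_table k = (if k = 6 then 495 else if k = 5 then 424 else if k = 4 then 351 else
     if k = 3 then 275 else if k = 2 then 195 else if k = 1 then 110 else 0)"

definition admissible4 :: "int \<Rightarrow> int \<Rightarrow> int \<Rightarrow> int \<Rightarrow> int \<Rightarrow> int \<Rightarrow> int \<Rightarrow> int \<Rightarrow> bool" where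
  "admissible4 b t a2 a3 a4 a5 a6 c4 \<longleftrightarrow>
     b + c4 * a4 + t * max (ifpos a2 720) (max (ifpos a3 240) (max (ifpos a4 110) (max (ifpos a5 200)
       (max (ifpos a6 30) (160 * a5 + 25 * a6))))) \<le> 92500"

definition admissible3 :: "int \<Rightarrow> int \<Rightarrow> int \<Rightarrow> int \<Rightarrow> int \<Rightarrow> int \<Rightarrow> int \<Rightarrow> int \<Rightarrow> bool" where
  "admissible3 b t a2 a3 a4 a5 a6 c4 \<longleftrightarrow>
     (if b + t * max (ifpos a2 720) (max (ifpos a3 240) (max (ifpos a4 440) (max (ifpos a5 200)
       (max (ifpos a6 30) (330 * a4 + 160 * a5 + 25 * a6))))) \<le> 92500 then True
      else admissible4 b t a2 a3 a4 a5 a6 c4)"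

definition admissible2 :: "int \<Rightarrow> int \<Rightarrow> int \<Rightarrow> int \<Rightarrow> int \<Rightarrow> int \<Rightarrow> int \<Rightarrow> int \<Rightarrow> int \<Rightarrow> bool" where
  "admissible2 b t a2 a3 a4 a5 a6 c3 c4 \<longleftrightarrow>
     (if b + t * max (ifpos a2 720) (max (ifpos a3 720) (max (ifpos a4 440) (max (ifpos a5 200)
       (max (ifpos a6 30) (480 * a3 + 330 * a4 + 160 * a5 + 25 * a6))))) \<le> 92500 then True
      else admissible3 (b + c3 * a3) t a2 a3 a4 a5 a6 c4)"

text \<open>Negative slack is excluded by \<open>U_lower\<close> and \<open>sum_U_le\<close>. The
  \<open>ifpos\<close> members of the maximum are the coefficients of a single element:
  \<open>kap j\<close> for sizes up to the threshold, \<open>j * kap j\<close> above it. The last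
  member adds up \<open>(j - 1) * kap j\<close> over the elements above the threshold.\<close>

definition admissible1 :: "int \<Rightarrow> int \<Rightarrow> int \<Rightarrow> int \<Rightarrow> int \<Rightarrow> int \<Rightarrow> int \<Rightarrow> int \<Rightarrow> int \<Rightarrow> int \<Rightarrow> bool" where
  "admissible1 b t a2 a3 a4 a5 a6 c2 c3 c4 \<longleftrightarrow>
     (if t < 0 then True else
      if b + t * max (ifpos a2 1440) (max (ifpos a3 720) (max (ifpos a4 440) (max (ifpos a5 200)
       (max (ifpos a6 30) (720 * a2 + 480 * a3 + 330 * a4 + 160 * a5 + 25 * a6))))) \<le> 92500 then True
      else admissible2 (b + c2 * a2) t a2 a3 a4 a5 a6 c3 c4)"

text \<open>In the first argument of \<open>admissible1\<close> the coefficient of \<open>aj\<close>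
  is \<open>weight j - kap j * pot j + j * kap j * marg (j - 1)\<close>. The last three arguments
  are \<open>(j - 1) * kap j * (c - marg (j - 1))\<close> for \<open>j = 2, 3, 4\<close>, where
  \<open>c\<close> is 85 if some element of the block is alone in its part and 110
  otherwise.\<close>

definition admissible :: "int \<Rightarrow> int \<Rightarrow> int \<Rightarrow> int \<Rightarrow> int \<Rightarrow> int \<Rightarrow> bool" where
  "admissible a1 a2 a3 a4 a5 a6 \<longleftrightarrow>
     admissible1 (68340 * a1 + 9930 * a2 + 6060 * a3 + 2555 * a4 + 1324 * a5 + 645 * a6)
       (pot_table (a1 + a2 + a3 + a4 + a5 + a6) - (110 * a1 + 85 * a2 + 80 * a3 + 76 * a4 + 73 * a5 + 71 * a6))
       a2 a3 a4 a5 a6 (ifpos (1 - a1) 18000) (if 0 < a1 then 2400 else 14400) (if 0 < a1 then 2970 else 11220)"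

text \<open>The finite check: all 924 profiles of at most six elements are evaluated.\<close>

lemma admissible_all:
  "list_all (\<lambda>a1. list_all (\<lambda>a2. list_all (\<lambda>a3. list_all (\<lambda>a4. list_all (\<lambda>a5. list_all (\<lambda>a6.
     admissible a1 a2 a3 a4 a5 a6) [0..6 - a1 - a2 - a3 - a4 - a5]) [0..6 - a1 - a2 - a3 - a4])
     [0..6 - a1 - a2 - a3]) [0..6 - a1 - a2]) [0..6 - a1]) [0..6]"
  by code_simp


lemma admissible_counts:
  assumes "0 \<le> a1" "0 \<le> a2" "0 \<le> a3" "0 \<le> a4" "0 \<le> a5" "0 \<le> a6" "a1 + a2 + a3 + a4 + a5 + a6 \<le> 6"
  shows "admissible a1 a2 a3 a4 a5 a6"
proof -
  have "\<forall>a1\<in>{0..6}. \<forall>a2\<in>{0..6 - a1}. \<forall>a3\<in>{0..6 - a1 - a2}. \<forall>a4\<in>{0..6 - a1 - a2 - a3}.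
      \<forall>a5\<in>{0..6 - a1 - a2 - a3 - a4}. \<forall>a6\<in>{0..6 - a1 - a2 - a3 - a4 - a5}. admissible a1 a2 a3 a4 a5 a6"
    using admissible_all unfolding list_all_iff set_upto .
  then show ?thesis
    using assms by auto
qed

text \<open>The multipliers of the part inequalities, also found by numerical search.\<close>

definition kap :: "nat \<Rightarrow> int" where
  "kap j = (if j < 7 then [0, 0, 720, 240, 110, 40, 5] ! j else 0)"

text \<open>The division is exact for \<open>j = 1, ..., 6\<close>, since 80820 is a multiple of 60;
  and 12480 is \<open>60 * 208\<close>.\<close>

definition weight :: "nat \<Rightarrow> int" where
  "weight j = 80820 div int j - 12480"

lemma kap_simps [simp]:
  "kap (Suc 0) = 0" "kap 2 = 720" "kap 3 = 240" "kap 4 = 110" "kap 5 = 40" "kap 6 = 5"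
  by (simp_all add: kap_def)

lemma kap_bounds: "0 \<le> kap j" "kap j \<le> 720"
proof -
  have "0 \<le> kap j \<and> kap j \<le> 720"
  proof (cases "j < 7")
    case True
    then have "j = 6 \<or> j < 6" by auto
    then show ?thesis by (auto dest!: less_6_cases simp: kap_def)
  qed (simp add: kap_def)
  then show "0 \<le> kap j" "kap j \<le> 720" by auto
qed

section \<open>Bounds for a single block\<close>

lemma sum_by_count:
  fixes \<phi> :: "nat \<Rightarrow> int"
  assumes "finite A" "\<And>e. e \<in> A \<Longrightarrow> 1 \<le> s e \<and> s e \<le> 6"
  shows "(\<Sum>e\<in>A. \<phi> (s e)) = int (card {e \<in> A. s e = 1}) * \<phi> 1 + int (card {e \<in> A. s e = 2}) * \<phi> 2 +
    int (card {e \<in> A. s e = 3}) * \<phi> 3 + int (card {e \<in> A. s e = 4}) * \<phi> 4 +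
    int (card {e \<in> A. s e = 5}) * \<phi> 5 + int (card {e \<in> A. s e = 6}) * \<phi> 6"
proof -
  have "(\<Sum>e\<in>A. \<phi> (s e)) = (\<Sum>j\<in>{1,2,3,4,5,6}. \<Sum>e\<in>{e \<in> A. s e = j}. \<phi> (s e))"
  proof (rule sum.group[symmetric])
    show "s ` A \<subseteq> {1, 2, 3, 4, 5, 6}"
    proof
      fix x assume "x \<in> s ` A"
      then have "1 \<le> x" "x \<le> 6" using assms(2) by auto
      then show "x \<in> {1, 2, 3, 4, 5, 6}" by auto
    qed
  qed (use assms in auto)
  also have "\<dots> = (\<Sum>j\<in>{1,2,3,4,5,6}. int (card {e \<in> A. s e = j}) * \<phi> j)"
    by (intro sum.cong[OF refl]) simp
  finally show ?thesis by simp
qed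

text \<open>Up to the threshold, \<open>kap * u\<close> is split off and the rest, a multiple of
  \<open>u + g\<close>, is bounded by the cap \<open>c\<close>. Above it, \<open>g\<close> is at
  most the remaining slack \<open>p - sum u A\<close>. The outcome is linear in the excesses of
  \<open>u\<close> over the marginals and in the remaining slack. These are nonnegative and add up
  to the total slack, and \<open>M\<close> dominates each coefficient.\<close>

lemma threshold_bound:
  fixes s :: "'a \<Rightarrow> nat" and u g :: "'a \<Rightarrow> int"
  assumes fin: "finite A" and size: "\<And>e. e \<in> A \<Longrightarrow> 1 \<le> s e"
    and lower: "\<And>e. e \<in> A \<Longrightarrow> int (marg (s e - 1)) \<le> u e"
    and whole: "\<And>e. e \<in> A \<Longrightarrow> g e + sum u A \<le> p" and total: "sum u A \<le> p"
    and capped: "\<And>e. e \<in> A \<Longrightarrow> s e \<noteq> 1 \<Longrightarrow> u e + g e \<le> c"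
    and M: "\<And>e. e \<in> A \<Longrightarrow> (if s e \<le> \<theta> then kap (s e) else int (s e) * kap (s e)) \<le> M"
      "(\<Sum>e\<in>A. if s e \<le> \<theta> then 0 else (int (s e) - 1) * kap (s e)) \<le> M"
  shows "(\<Sum>e\<in>A. int (s e) * kap (s e) * u e + (int (s e) - 1) * kap (s e) * g e) \<le>
    (\<Sum>e\<in>A. int (s e) * kap (s e) * int (marg (s e - 1)) +
      (if s e \<le> \<theta> then (int (s e) - 1) * kap (s e) * (c - int (marg (s e - 1))) else 0)) +
    M * (p - (\<Sum>e\<in>A. int (marg (s e - 1))))"
proof -
  define d where "d e = int (marg (s e - 1))" for e
  define k where "k e = kap (s e)" for e
  define D where "D e = (if s e \<le> \<theta> then 0 else (int (s e) - 1) * k e)" for e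
  have k: "0 \<le> k e" for e
    by (simp add: k_def kap_bounds)
  have D: "(\<Sum>e\<in>A. D e) \<le> M"
    using M(2) unfolding D_def k_def .
  have pointwise: "int (s e) * k e * u e + (int (s e) - 1) * k e * g e \<le>
      (int (s e) * k e * d e + (if s e \<le> \<theta> then (int (s e) - 1) * k e * (c - d e) else 0)) +
      M * (u e - d e) + D e * (p - sum u A)" if e: "e \<in> A" for e
  proof (cases "s e \<le> \<theta>")
    case True
    have "0 \<le> (int (s e) - 1) * k e"
      using size[OF e] k by simp
    \<comment> \<open>The cap may fail for a part of size 1, but there the multiplier
      \<open>kap\<close> is 0.\<close>
    moreover have "u e + g e \<le> c \<or> k e = 0"
      using capped[OF e] by (cases "s e = 1") (auto simp: k_def)
    ultimately have "(int (s e) - 1) * k e * (u e + g e) \<le> (int (s e) - 1) * k e * c"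
      by (auto intro: mult_left_mono)
    moreover have "k e * (u e - d e) \<le> M * (u e - d e)"
      using M(1)[OF e] True lower[OF e] by (intro mult_right_mono) (auto simp: k_def d_def)
    ultimately show ?thesis
      using True by (simp add: D_def algebra_simps)
  next
    case False
    have "0 \<le> (int (s e) - 1) * k e"
      using size[OF e] k by simp
    then have "(int (s e) - 1) * k e * g e \<le> (int (s e) - 1) * k e * (p - sum u A)"
      using whole[OF e] by (intro mult_left_mono) auto
    moreover have "int (s e) * k e * (u e - d e) \<le> M * (u e - d e)"
      using M(1)[OF e] False lower[OF e] by (intro mult_right_mono) (auto simp: k_def d_def)
    ultimately show ?thesis
      using False by (simp add: D_def algebra_simps)
  qed
  have "(\<Sum>e\<in>A. int (s e) * k e * u e + (int (s e) - 1) * k e * g e) \<le>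
      (\<Sum>e\<in>A. (int (s e) * k e * d e + (if s e \<le> \<theta> then (int (s e) - 1) * k e * (c - d e) else 0)) +
      M * (u e - d e) + D e * (p - sum u A))"
    by (rule sum_mono) (rule pointwise)
  also have "\<dots> = (\<Sum>e\<in>A. int (s e) * k e * d e + (if s e \<le> \<theta> then (int (s e) - 1) * k e * (c - d e) else 0)) +
      M * (sum u A - sum d A) + sum D A * (p - sum u A)"
    unfolding sum.distrib sum_distrib_right[symmetric] sum_distrib_left[symmetric] sum_subtractf ..
  also have "sum D A * (p - sum u A) \<le> M * (p - sum u A)"
    using D total by (intro mult_right_mono) auto
  finally show ?thesis
    unfolding k_def d_def by (simp only: right_diff_distrib) linarith
qed

lemma block_bound:
  fixes s :: "'a \<Rightarrow> nat" and u g :: "'a \<Rightarrow> int"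
  assumes fin: "finite A" and card: "card A \<le> 6" and size: "\<And>e. e \<in> A \<Longrightarrow> 1 \<le> s e \<and> s e \<le> 6"
    and lower: "\<And>e. e \<in> A \<Longrightarrow> int (marg (s e - 1)) \<le> u e"
    and whole: "\<And>e. e \<in> A \<Longrightarrow> g e + sum u A \<le> int (pot (card A))" and total: "sum u A \<le> int (pot (card A))"
    and leaf: "\<And>e. e \<in> A \<Longrightarrow> u e + g e \<le> 110"
    and pair: "\<And>e e'. e \<in> A \<Longrightarrow> e' \<in> A \<Longrightarrow> e \<noteq> e' \<Longrightarrow> u e' + (u e + g e) \<le> 195"
  shows "(\<Sum>e\<in>A. weight (s e) - kap (s e) * int (pot (s e)) + int (s e) * kap (s e) * u e +
    (int (s e) - 1) * kap (s e) * g e) \<le> 92500"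
proof -
  define a where "a j = int (card {e \<in> A. s e = j})" for j
  \<comment> \<open>An element alone in its part has \<open>u\<close> at least 110, so
    \<open>pair\<close> leaves at most 195 - 110 = 85 for every other element of the block.\<close>
  define c :: int where "c = (if 0 < a 1 then 85 else 110)"
  have capped: "u e + g e \<le> c" if e: "e \<in> A" "s e \<noteq> 1" for e
  proof (cases "0 < a 1")
    case True
    then have "{e \<in> A. s e = 1} \<noteq> {}"
      by (auto simp: a_def card_gt_0_iff)
    then obtain e' where e': "e' \<in> A" "s e' = 1" by auto
    then have "110 \<le> u e'"
      using lower[of e'] by simp
    moreover have "e \<noteq> e'"
      using e e' by auto
    ultimately show ?thesis
      using pair[of e e'] e e' True by (simp add: c_def)
  qed (use leaf e in \<open>simp add: c_def\<close>)
  have count: "(\<Sum>e\<in>A. \<phi> (s e)) = a 1 * \<phi> 1 + a 2 * \<phi> 2 + a 3 * \<phi> 3 + a 4 * \<phi> 4 + a 5 * \<phi> 5 + a 6 * \<phi> 6"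
    for \<phi> :: "nat \<Rightarrow> int"
    unfolding a_def by (rule sum_by_count[OF fin size])
  have pos: "0 < a (s e)" if "e \<in> A" for e
    using that fin by (auto simp: a_def card_gt_0_iff)
  have a0: "0 \<le> a j" for j
    by (simp add: a_def)
  have card_a: "int (card A) = a 1 + a 2 + a 3 + a 4 + a 5 + a 6"
    using count[where \<phi> = "\<lambda>_. 1"] by simp
  define t where "t = int (pot (card A)) - (110 * a 1 + 85 * a 2 + 80 * a 3 + 76 * a 4 + 73 * a 5 + 71 * a 6)"
  have marg_sum: "(\<Sum>e\<in>A. int (marg (s e - 1))) = 110 * a 1 + 85 * a 2 + 80 * a 3 + 76 * a 4 + 73 * a 5 + 71 * a 6"
    using count[where \<phi> = "\<lambda>j. int (marg (j - 1))"] by simp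
  have t: "0 \<le> t"
    using sum_mono[of A "\<lambda>e. int (marg (s e - 1))" u, OF lower] total marg_sum by (simp add: t_def)
  let ?S = "\<Sum>e\<in>A. weight (s e) - kap (s e) * int (pot (s e)) + int (s e) * kap (s e) * u e +
    (int (s e) - 1) * kap (s e) * g e"
  have bound: "?S \<le> (\<Sum>e\<in>A. weight (s e) - kap (s e) * int (pot (s e)) + int (s e) * kap (s e) * int (marg (s e - 1)) +
      (if s e \<le> \<theta> then (int (s e) - 1) * kap (s e) * (c - int (marg (s e - 1))) else 0)) + M * t"
    if "\<And>j. 1 \<le> j \<Longrightarrow> j \<le> 6 \<Longrightarrow> 0 < a j \<Longrightarrow> (if j \<le> \<theta> then kap j else int j * kap j) \<le> M"
      "(\<Sum>e\<in>A. if s e \<le> \<theta> then 0 else (int (s e) - 1) * kap (s e)) \<le> M" for M \<theta>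
  proof -
    have "(\<Sum>e\<in>A. int (s e) * kap (s e) * u e + (int (s e) - 1) * kap (s e) * g e) \<le>
      (\<Sum>e\<in>A. int (s e) * kap (s e) * int (marg (s e - 1)) +
        (if s e \<le> \<theta> then (int (s e) - 1) * kap (s e) * (c - int (marg (s e - 1))) else 0)) +
      M * (int (pot (card A)) - (\<Sum>e\<in>A. int (marg (s e - 1))))"
      by (rule threshold_bound[OF fin _ lower whole total capped])
        (use size pos that in auto)
    then show ?thesis
      unfolding marg_sum t_def[symmetric] by (simp add: sum.distrib sum_subtractf)
  qed
  have small: "1 \<le> j \<Longrightarrow> j \<le> 6 \<Longrightarrow> j = 1 \<or> j = 2 \<or> j = 3 \<or> j = 4 \<or> j = 5 \<or> j = 6" for j :: nat
    by auto
  define b where "b = 68340 * a 1 + 9930 * a 2 + 6060 * a 3 + 2555 * a 4 + 1324 * a 5 + 645 * a 6"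
  define c2 where "c2 = ifpos (1 - a 1) 18000"
  define c3 :: int where "c3 = (if 0 < a 1 then 2400 else 14400)"
  define c4 :: int where "c4 = (if 0 < a 1 then 2970 else 11220)"
  have adm: "admissible1 b t (a 2) (a 3) (a 4) (a 5) (a 6) c2 c3 c4"
  proof -
    have "card A = 0 \<or> card A = 1 \<or> card A = 2 \<or> card A = 3 \<or> card A = 4 \<or> card A = 5 \<or> card A = 6"
      using card by auto
    then have "pot_table (int (card A)) = int (pot (card A))"
      by (auto simp: pot_table_def)
    then show ?thesis
      using admissible_counts[of "a 1" "a 2" "a 3" "a 4" "a 5" "a 6"] a0 card card_a
      by (simp add: admissible_def b_def t_def c2_def c3_def c4_def)
  qed
  note simps = c_def c2_def c3_def c4_def b_def ifpos_def
  define \<phi> where "\<phi> \<theta> j = weight j - kap j * int (pot j) + int j * kap j * int (marg (j - 1)) +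
    (if j \<le> \<theta> then (int j - 1) * kap j * (c - int (marg (j - 1))) else 0)" for \<theta> j :: nat
  have 1: "?S \<le> b + t * max (ifpos (a 2) 1440) (max (ifpos (a 3) 720) (max (ifpos (a 4) 440)
      (max (ifpos (a 5) 200) (max (ifpos (a 6) 30) (720 * a 2 + 480 * a 3 + 330 * a 4 + 160 * a 5 + 25 * a 6)))))" (is "_ \<le> _ + t * ?M")
  proof -
    obtain M where M_def: "M = ?M" by blast
    have M: "ifpos (a 2) 1440 \<le> M" "ifpos (a 3) 720 \<le> M" "ifpos (a 4) 440 \<le> M"
      "ifpos (a 5) 200 \<le> M" "ifpos (a 6) 30 \<le> M" "720 * a 2 + 480 * a 3 + 330 * a 4 + 160 * a 5 + 25 * a 6 \<le> M"
      unfolding M_def by (intro max.cobounded1 max.coboundedI2 order_refl)+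
    have "0 \<le> M"
      using M(5) ifpos_nonneg[of 30 "a 6"] by linarith
    have "?S \<le> (\<Sum>e\<in>A. \<phi> 1 (s e)) + M * t"
      unfolding \<phi>_def
    proof (rule bound)
      show "(if j \<le> 1 then kap j else int j * kap j) \<le> M" if "1 \<le> j" "j \<le> 6" "0 < a j" for j
        using small[OF that(1,2)] that(3) M \<open>0 \<le> M\<close> by (elim disjE) simp_all
      show "(\<Sum>e\<in>A. if s e \<le> 1 then 0 else (int (s e) - 1) * kap (s e)) \<le> M"
        using count[where \<phi> = "\<lambda>j. if j \<le> 1 then 0 else (int j - 1) * kap j"] M(6) by simp
    qed
    moreover have "(\<Sum>e\<in>A. \<phi> 1 (s e)) = b"
      using count[where \<phi> = "\<phi> 1"] a0[of 1] by (simp add: \<phi>_def weight_def simps)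
    ultimately show ?thesis
      unfolding M_def[symmetric] by (simp only: mult.commute)
  qed
  have 2: "?S \<le> b + c2 * a 2 + t * max (ifpos (a 2) 720) (max (ifpos (a 3) 720) (max (ifpos (a 4) 440)
      (max (ifpos (a 5) 200) (max (ifpos (a 6) 30) (480 * a 3 + 330 * a 4 + 160 * a 5 + 25 * a 6)))))" (is "_ \<le> _ + t * ?M")
  proof -
    obtain M where M_def: "M = ?M" by blast
    have M: "ifpos (a 2) 720 \<le> M" "ifpos (a 3) 720 \<le> M" "ifpos (a 4) 440 \<le> M"
      "ifpos (a 5) 200 \<le> M" "ifpos (a 6) 30 \<le> M" "480 * a 3 + 330 * a 4 + 160 * a 5 + 25 * a 6 \<le> M"
      unfolding M_def by (intro max.cobounded1 max.coboundedI2 order_refl)+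
    have "0 \<le> M"
      using M(5) ifpos_nonneg[of 30 "a 6"] by linarith
    have "?S \<le> (\<Sum>e\<in>A. \<phi> 2 (s e)) + M * t"
      unfolding \<phi>_def
    proof (rule bound)
      show "(if j \<le> 2 then kap j else int j * kap j) \<le> M" if "1 \<le> j" "j \<le> 6" "0 < a j" for j
        using small[OF that(1,2)] that(3) M \<open>0 \<le> M\<close> by (elim disjE) simp_all
      show "(\<Sum>e\<in>A. if s e \<le> 2 then 0 else (int (s e) - 1) * kap (s e)) \<le> M"
        using count[where \<phi> = "\<lambda>j. if j \<le> 2 then 0 else (int j - 1) * kap j"] M(6) by simp
    qed
    moreover have "(\<Sum>e\<in>A. \<phi> 2 (s e)) = b + c2 * a 2"
      using count[where \<phi> = "\<phi> 2"] a0[of 1] by (simp add: \<phi>_def weight_def simps)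
    ultimately show ?thesis
      unfolding M_def[symmetric] by (simp only: mult.commute)
  qed
  have 3: "?S \<le> b + c2 * a 2 + c3 * a 3 + t * max (ifpos (a 2) 720) (max (ifpos (a 3) 240) (max (ifpos (a 4) 440)
      (max (ifpos (a 5) 200) (max (ifpos (a 6) 30) (330 * a 4 + 160 * a 5 + 25 * a 6)))))" (is "_ \<le> _ + t * ?M")
  proof -
    obtain M where M_def: "M = ?M" by blast
    have M: "ifpos (a 2) 720 \<le> M" "ifpos (a 3) 240 \<le> M" "ifpos (a 4) 440 \<le> M"
      "ifpos (a 5) 200 \<le> M" "ifpos (a 6) 30 \<le> M" "330 * a 4 + 160 * a 5 + 25 * a 6 \<le> M"
      unfolding M_def by (intro max.cobounded1 max.coboundedI2 order_refl)+
    have "0 \<le> M"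
      using M(5) ifpos_nonneg[of 30 "a 6"] by linarith
    have "?S \<le> (\<Sum>e\<in>A. \<phi> 3 (s e)) + M * t"
      unfolding \<phi>_def
    proof (rule bound)
      show "(if j \<le> 3 then kap j else int j * kap j) \<le> M" if "1 \<le> j" "j \<le> 6" "0 < a j" for j
        using small[OF that(1,2)] that(3) M \<open>0 \<le> M\<close> by (elim disjE) simp_all
      show "(\<Sum>e\<in>A. if s e \<le> 3 then 0 else (int (s e) - 1) * kap (s e)) \<le> M"
        using count[where \<phi> = "\<lambda>j. if j \<le> 3 then 0 else (int j - 1) * kap j"] M(6) by simp
    qed
    moreover have "(\<Sum>e\<in>A. \<phi> 3 (s e)) = b + c2 * a 2 + c3 * a 3"
      using count[where \<phi> = "\<phi> 3"] a0[of 1] by (simp add: \<phi>_def weight_def simps)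
    ultimately show ?thesis
      unfolding M_def[symmetric] by (simp only: mult.commute)
  qed
  have 4: "?S \<le> b + c2 * a 2 + c3 * a 3 + c4 * a 4 + t * max (ifpos (a 2) 720) (max (ifpos (a 3) 240) (max (ifpos (a 4) 110)
      (max (ifpos (a 5) 200) (max (ifpos (a 6) 30) (160 * a 5 + 25 * a 6)))))" (is "_ \<le> _ + t * ?M")
  proof -
    obtain M where M_def: "M = ?M" by blast
    have M: "ifpos (a 2) 720 \<le> M" "ifpos (a 3) 240 \<le> M" "ifpos (a 4) 110 \<le> M"
      "ifpos (a 5) 200 \<le> M" "ifpos (a 6) 30 \<le> M" "160 * a 5 + 25 * a 6 \<le> M"
      unfolding M_def by (intro max.cobounded1 max.coboundedI2 order_refl)+
    have "0 \<le> M"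
      using M(5) ifpos_nonneg[of 30 "a 6"] by linarith
    have "?S \<le> (\<Sum>e\<in>A. \<phi> 4 (s e)) + M * t"
      unfolding \<phi>_def
    proof (rule bound)
      show "(if j \<le> 4 then kap j else int j * kap j) \<le> M" if "1 \<le> j" "j \<le> 6" "0 < a j" for j
        using small[OF that(1,2)] that(3) M \<open>0 \<le> M\<close> by (elim disjE) simp_all
      show "(\<Sum>e\<in>A. if s e \<le> 4 then 0 else (int (s e) - 1) * kap (s e)) \<le> M"
        using count[where \<phi> = "\<lambda>j. if j \<le> 4 then 0 else (int j - 1) * kap j"] M(6) by simp
    qed
    moreover have "(\<Sum>e\<in>A. \<phi> 4 (s e)) = b + c2 * a 2 + c3 * a 3 + c4 * a 4"
      using count[where \<phi> = "\<phi> 4"] a0[of 1] by (simp add: \<phi>_def weight_def simps)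
    ultimately show ?thesis
      unfolding M_def[symmetric] by (simp only: mult.commute)
  qed
  have "\<not> t < 0"
    using t by simp
  then show ?thesis
    using adm order_trans[OF 1] order_trans[OF 2] order_trans[OF 3] order_trans[OF 4]
    unfolding admissible1_def admissible2_def admissible3_def admissible4_def
    by (simp only: if_bool_eq_disj simp_thms) blast
qed

subsection \<open>The size of a local optimum\<close>

primrec radius :: "nat \<Rightarrow> nat" where
  "radius 0 = 1"
| "radius (Suc j) = 6 + 30 * radius j"

lemma radius_pos: "1 \<le> radius j"
  by (induction j) auto

lemma radius_mono: "i \<le> j \<Longrightarrow> radius i \<le> radius j"
  by (rule lift_Suc_mono_le) auto

section \<open>Slacks of blocks, inequalities of parts, and their combination\<close>

context local_optimum
begin

text \<open>\<open>U n e + gap n e\<close> is the least value of \<open>pot (card Y)\<close> minus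
  the \<open>U n\<close> of the other members of \<open>Y\<close>: the price of placing
  \<open>e\<close> in its block when the others contribute. It is the message from the block to
  \<open>e\<close>, as \<open>U n e\<close> is the message from the part side.\<close>

definition gap :: "nat \<Rightarrow> 'a \<Rightarrow> int" where
  "gap n e = Min ((\<lambda>Y. int (pot (card Y)) - (\<Sum>e'\<in>Y. U n e')) ` {Y. Y \<subseteq> Act \<inter> block (\<tau> e) \<and> e \<in> Y})"

lemma fin_gap_sets: "finite {Y. Y \<subseteq> Act \<inter> block (\<tau> e) \<and> e \<in> Y}"
  by (rule finite_subset[of _ "Pow Act"]) (auto simp: fin_Act)

lemma gap_le: "Y \<subseteq> Act \<Longrightarrow> Y \<subseteq> block (\<tau> e) \<Longrightarrow> e \<in> Y \<Longrightarrow> gap n e \<le> int (pot (card Y)) - (\<Sum>e'\<in>Y. U n e')"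
  unfolding gap_def using fin_gap_sets by (intro Min_le) auto

lemma gap_attained:
  assumes "e \<in> Act"
  obtains Y where "Y \<subseteq> Act" "Y \<subseteq> block (\<tau> e)" "e \<in> Y" "gap n e = int (pot (card Y)) - (\<Sum>e'\<in>Y. U n e')"
proof -
  let ?S = "{Y. Y \<subseteq> Act \<inter> block (\<tau> e) \<and> e \<in> Y}"
  have "{e} \<in> ?S"
    using assms Act_E by (auto simp: fiber_def)
  then have "gap n e \<in> (\<lambda>Y. int (pot (card Y)) - (\<Sum>e'\<in>Y. U n e')) ` ?S"
    unfolding gap_def using fin_gap_sets by (intro Min_in) auto
  then show ?thesis using that by auto
qed

lemma U_upper:
  assumes "e \<in> Act" "1 \<le> n" "n \<le> q"
  shows "U n e \<le> 110"
  using sum_U_le[of "{e}" "\<tau> e" n] assms Act_E by (auto simp: fiber_def)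

lemma size_le_6: "e \<in> Act \<Longrightarrow> size e \<le> 6"
  by (simp add: Act_def)

lemma U_ge_71:
  assumes "e \<in> Act" "1 \<le> n"
  shows "71 \<le> U n e"
proof -
  have "71 \<le> marg (size e - 1)"
    using size_le_6[OF assms(1)] by (intro marg_lower) auto
  then show ?thesis
    using U_lower[OF assms] by linarith
qed

text \<open>Seven active elements would contribute at least 7 * 71 = 497, more than
  \<open>pot 7 = 495\<close>. This leaves finitely many block profiles.\<close>

lemma card_active_block:
  assumes "7 \<le> q"
  shows "card (Act \<inter> block v) \<le> 6"
proof (rule ccontr)
  assume "\<not> ?thesis"
  then have "7 \<le> card (Act \<inter> block v)" by simp
  then obtain Y where Y: "Y \<subseteq> Act \<inter> block v" "card Y = 7"
    by (meson obtain_subset_with_card_n)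
  have "71 \<le> U 1 e" if "e \<in> Y" for e
    using that Y(1) by (intro U_ge_71) auto
  then have "(\<Sum>e\<in>Y. 71) \<le> (\<Sum>e\<in>Y. U 1 e)"
    by (rule sum_mono)
  also have "\<dots> \<le> int (pot (card Y))"
    using Y assms by (intro sum_U_le[of Y v]) auto
  finally show False
    using Y(2) by (simp add: pot_ge_6)
qed

text \<open>This is \<open>part_le_U\<close> for the sets \<open>Y e\<close> that attain the
  gaps.\<close>

lemma part_inequality:
  assumes P: "card (part v) \<le> 6" and e0: "e0 \<in> part v" and n: "1 \<le> n" "6 + 30 * n \<le> q"
  shows "int (pot (card (part v))) \<le> U (6 + 30 * n) e0 + (\<Sum>e\<in>part v - {e0}. U n e + gap n e)"
proof -
  have P_Act: "part v \<subseteq> Act"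
    using P by (auto simp: Act_def size_def fiber_def)
  have "\<forall>e\<in>part v. \<exists>Y. e \<in> Y \<and> Y \<subseteq> Act \<and> Y \<subseteq> block (\<tau> e) \<and>
      gap n e = int (pot (card Y)) - (\<Sum>e'\<in>Y. U n e')"
    using P_Act by (meson gap_attained subsetD)
  then obtain Y where Y: "\<And>e. e \<in> part v \<Longrightarrow> e \<in> Y e \<and> Y e \<subseteq> Act \<and> Y e \<subseteq> block (\<tau> e) \<and>
      gap n e = int (pot (card (Y e))) - (\<Sum>e'\<in>Y e. U n e')"
    by (metis bchoice)
  have finY: "finite (Y e)" if "e \<in> part v" for e
    using Y[OF that] fin_Act finite_subset by blast
  have "int (pot (card (part v))) +
      (\<Sum>e\<in>part v - {e0}. (\<Sum>e'\<in>Y e - {e}. U n e') - int (pot (card (Y e)))) \<le> U (6 + 30 * n) e0"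
  proof (rule part_le_U[OF P e0 _ n])
    fix e assume e: "e \<in> part v"
    have "card (Y e) \<le> card (Act \<inter> block (\<tau> e))"
      using Y[OF e] fin_Act by (intro card_mono) auto
    also have "\<dots> \<le> 6"
      using n by (intro card_active_block) auto
    finally show "e \<in> Y e \<and> Y e \<subseteq> Act \<and> Y e \<subseteq> block (\<tau> e) \<and> card (Y e) \<le> 6"
      using Y[OF e] by simp
  qed
  moreover have "(\<Sum>e\<in>part v - {e0}. (\<Sum>e'\<in>Y e - {e}. U n e') - int (pot (card (Y e)))) =
      (\<Sum>e\<in>part v - {e0}. - (U n e + gap n e))"
  proof (rule sum.cong[OF refl])
    fix e assume "e \<in> part v - {e0}"
    then have "e \<in> part v" by simp
    then have "(\<Sum>e'\<in>Y e. U n e') = U n e + (\<Sum>e'\<in>Y e - {e}. U n e')"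
      using Y finY by (intro sum.remove) auto
    then show "(\<Sum>e'\<in>Y e - {e}. U n e') - int (pot (card (Y e))) = - (U n e + gap n e)"
      using Y[OF \<open>e \<in> part v\<close>] by simp
  qed
  ultimately show ?thesis
    unfolding sum_negf by linarith
qed

text \<open>The part inequality is summed over all choices of \<open>e0\<close> and scaled by
  \<open>kap\<close>. Each element is \<open>e0\<close> once, with the larger radius, and one of the
  others \<open>size e - 1\<close> times. The change of radius is split off as the last
  term.\<close>

lemma part_weighted_inequality:
  assumes P: "card (part v) \<le> 6" and n: "1 \<le> n" "6 + 30 * n \<le> q"
  shows "(\<Sum>e\<in>part v. kap (size e) * int (pot (size e))) \<le>
    (\<Sum>e\<in>part v. int (size e) * kap (size e) * U n e + (int (size e) - 1) * kap (size e) * gap n e +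
      kap (size e) * (U (6 + 30 * n) e - U n e))"
proof -
  let ?P = "part v" and ?s = "card (part v)"
  have fin: "finite ?P"
    using fin_E by (simp add: fiber_def)
  have size: "size e = ?s" if "e \<in> ?P" for e
    using that by (simp add: size_def fiber_def)
  have "(\<Sum>e0\<in>?P. int (pot ?s)) \<le> (\<Sum>e0\<in>?P. U (6 + 30 * n) e0 + (\<Sum>e\<in>?P - {e0}. U n e + gap n e))"
    by (intro sum_mono part_inequality P n)
  also have "\<dots> = (\<Sum>e0\<in>?P. U (6 + 30 * n) e0 + ((\<Sum>e\<in>?P. U n e + gap n e) - (U n e0 + gap n e0)))"
    using fin by (intro sum.cong[OF refl]) (simp add: sum_diff1)
  also have "\<dots> = (\<Sum>e\<in>?P. int ?s * U n e + (int ?s - 1) * gap n e + (U (6 + 30 * n) e - U n e))"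
    by (simp add: sum.distrib sum_subtractf sum_distrib_left[symmetric] algebra_simps)
  finally have *: "kap ?s * (\<Sum>e\<in>?P. int (pot ?s)) \<le>
      kap ?s * (\<Sum>e\<in>?P. int ?s * U n e + (int ?s - 1) * gap n e + (U (6 + 30 * n) e - U n e))"
    by (intro mult_left_mono kap_bounds)
  have "(\<Sum>e\<in>?P. kap (size e) * int (pot (size e))) = kap ?s * (\<Sum>e\<in>?P. int (pot ?s))"
    unfolding sum_distrib_left using size by (intro sum.cong[OF refl]) simp
  moreover have "(\<Sum>e\<in>?P. int (size e) * kap (size e) * U n e + (int (size e) - 1) * kap (size e) * gap n e +
      kap (size e) * (U (6 + 30 * n) e - U n e)) =
      kap ?s * (\<Sum>e\<in>?P. int ?s * U n e + (int ?s - 1) * gap n e + (U (6 + 30 * n) e - U n e))"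
    unfolding sum_distrib_left using size by (intro sum.cong[OF refl]) (simp add: algebra_simps)
  ultimately show ?thesis
    using * by simp
qed

lemma part_active: "v \<in> \<sigma> ` Act \<Longrightarrow> {e \<in> Act. \<sigma> e = v} = part v \<and> card (part v) \<le> 6"
  by (auto simp: Act_def size_def fiber_def)

text \<open>The weak duality step. The part inequalities are summed over the parts and the block
  bounds over the blocks; the terms \<open>X\<close> and \<open>kap * pot\<close> cancel. Only the
  growth of \<open>U\<close> remains, with a factor \<open>kap\<close> of at most 720.\<close>

lemma weight_sum_bound:
  assumes n: "1 \<le> n" "6 + 30 * n \<le> q"
  shows "(\<Sum>e\<in>Act. weight (size e)) \<le>
    92500 * int (card (\<tau> ` Act)) + 720 * (\<Sum>e\<in>Act. U (6 + 30 * n) e - U n e)"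
proof -
  define X where "X e = int (size e) * kap (size e) * U n e + (int (size e) - 1) * kap (size e) * gap n e" for e
  define D where "D e = U (6 + 30 * n) e - U n e" for e
  have D: "0 \<le> D e" if "e \<in> Act" for e
    using U_mono[OF that n(1), of "6 + 30 * n"] by (simp add: D_def)
  have "(\<Sum>e\<in>Act. kap (size e) * int (pot (size e))) =
      (\<Sum>v\<in>\<sigma> ` Act. \<Sum>e\<in>{e \<in> Act. \<sigma> e = v}. kap (size e) * int (pot (size e)))"
    by (rule sum.image_gen[OF fin_Act])
  also have "\<dots> \<le> (\<Sum>v\<in>\<sigma> ` Act. \<Sum>e\<in>{e \<in> Act. \<sigma> e = v}. X e + kap (size e) * D e)"
  proof (rule sum_mono)
    fix v assume "v \<in> \<sigma> ` Act"
    from part_active[OF this] show "(\<Sum>e\<in>{e \<in> Act. \<sigma> e = v}. kap (size e) * int (pot (size e))) \<le>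
        (\<Sum>e\<in>{e \<in> Act. \<sigma> e = v}. X e + kap (size e) * D e)"
      using part_weighted_inequality[OF _ n, of v] by (simp add: X_def D_def)
  qed
  also have "\<dots> = (\<Sum>e\<in>Act. X e + kap (size e) * D e)"
    by (rule sum.image_gen[OF fin_Act, symmetric])
  also have "\<dots> \<le> (\<Sum>e\<in>Act. X e + 720 * D e)"
    using D by (intro sum_mono add_left_mono mult_right_mono kap_bounds) auto
  finally have parts: "(\<Sum>e\<in>Act. kap (size e) * int (pot (size e))) \<le> (\<Sum>e\<in>Act. X e) + 720 * (\<Sum>e\<in>Act. D e)"
    by (simp add: sum.distrib sum_distrib_left)
  have "(\<Sum>e\<in>Act. weight (size e) - kap (size e) * int (pot (size e)) + X e) =
      (\<Sum>v\<in>\<tau> ` Act. \<Sum>e\<in>{e \<in> Act. \<tau> e = v}. weight (size e) - kap (size e) * int (pot (size e)) + X e)"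
    by (rule sum.image_gen[OF fin_Act])
  also have "\<dots> \<le> (\<Sum>v\<in>\<tau> ` Act. 92500)"
  proof (rule sum_mono)
    fix v
    let ?A = "{e \<in> Act. \<tau> e = v}"
    have A: "?A = Act \<inter> block v"
      using Act_E by (auto simp: fiber_def)
    have fin: "finite ?A"
      using fin_Act by simp
    have card: "card ?A \<le> 6"
      unfolding A using n by (intro card_active_block) auto
    have gap: "gap n e + (\<Sum>e'\<in>Y. U n e') \<le> int (pot (card Y))" if "Y \<subseteq> ?A" "e \<in> Y" for Y e
    proof -
      have "Y \<subseteq> Act" "Y \<subseteq> block (\<tau> e)"
        using that Act_E by (auto simp: fiber_def)
      then show ?thesis
        using gap_le[of Y e n] that(2) by simp
    qed
    have "(\<Sum>e\<in>?A. weight (size e) - kap (size e) * int (pot (size e)) + int (size e) * kap (size e) * U n e +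
        (int (size e) - 1) * kap (size e) * gap n e) \<le> 92500"
    proof (rule block_bound[OF fin card])
      show "1 \<le> size e \<and> size e \<le> 6" if "e \<in> ?A" for e
        using that size_pos size_le_6 Act_E by auto
      show "int (marg (size e - 1)) \<le> U n e" if "e \<in> ?A" for e
        using that n by (intro U_lower) auto
      show "gap n e + (\<Sum>e'\<in>?A. U n e') \<le> int (pot (card ?A))" if "e \<in> ?A" for e
        by (rule gap[OF subset_refl that])
      have "card ?A * n \<le> 6 * n"
        using card by (intro mult_right_mono) auto
      then have "card ?A * n \<le> q"
        using n by linarith
      then show "(\<Sum>e\<in>?A. U n e) \<le> int (pot (card ?A))"
        using n by (intro sum_U_le[of _ v]) (auto simp: fiber_def Act_def)
      show "U n e + gap n e \<le> 110" if "e \<in> ?A" for e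
        using gap[of "{e}" e] that by simp
      show "U n e' + (U n e + gap n e) \<le> 195" if "e \<in> ?A" "e' \<in> ?A" "e \<noteq> e'" for e e'
        using gap[of "{e, e'}" e] that by (simp add: pot_Suc)
    qed
    then show "(\<Sum>e\<in>?A. weight (size e) - kap (size e) * int (pot (size e)) + X e) \<le> 92500"
      by (simp add: X_def add.assoc)
  qed
  finally have "(\<Sum>e\<in>Act. weight (size e)) - (\<Sum>e\<in>Act. kap (size e) * int (pot (size e))) + (\<Sum>e\<in>Act. X e)
      \<le> 92500 * int (card (\<tau> ` Act))"
    by (simp add: sum.distrib sum_subtractf)
  then show ?thesis
    using parts unfolding D_def by linarith
qed

text \<open>The increments of \<open>U\<close> telescope along the radii, hence one of the 300 steps is small.\<close>

lemma small_step:
  assumes q: "7 * radius 300 \<le> q"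
  obtains j where "j < 300"
    "300 * (\<Sum>e\<in>Act. U (radius (Suc j)) e - U (radius j) e) \<le> 234 * int (card (\<tau> ` Act))"
proof -
  define f where "f j = (\<Sum>e\<in>Act. U (radius (Suc j)) e - U (radius j) e)" for j
  have "(\<Sum>j<300. f j) = (\<Sum>e\<in>Act. \<Sum>j<300. U (radius (Suc j)) e - U (radius j) e)"
    unfolding f_def by (rule sum.swap)
  also have "\<dots> = (\<Sum>e\<in>Act. U (radius 300) e - U (radius 0) e)"
    by (intro sum.cong[OF refl] sum_lessThan_telescope)
  \<comment> \<open>\<open>U\<close> stays between 71 and 110, hence 39; with at most six active
    elements per block this gives 234.\<close>
  also have "\<dots> \<le> (\<Sum>e\<in>Act. 39)"
  proof (rule sum_mono)
    fix e assume e: "e \<in> Act"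
    have "U (radius 300) e \<le> 110"
      using q radius_pos[of 300] by (intro U_upper e) auto
    moreover have "71 \<le> U (radius 0) e"
      by (intro U_ge_71 e radius_pos)
    ultimately show "U (radius 300) e - U (radius 0) e \<le> 39" by linarith
  qed
  also have "\<dots> = 39 * int (card Act)"
    by simp
  also have "int (card Act) = (\<Sum>v\<in>\<tau> ` Act. int (card {e \<in> Act. \<tau> e = v}))"
    using sum.image_gen[OF fin_Act, of "\<lambda>_. 1::int" \<tau>] by simp
  also have "(\<Sum>v\<in>\<tau> ` Act. int (card {e \<in> Act. \<tau> e = v})) \<le> (\<Sum>v\<in>\<tau> ` Act. 6)"
  proof (rule sum_mono)
    fix v
    have "{e \<in> Act. \<tau> e = v} = Act \<inter> block v"
      using Act_E by (auto simp: fiber_def)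
    then show "int (card {e \<in> Act. \<tau> e = v}) \<le> 6"
      using card_active_block[of v] q radius_pos[of 300] by simp
  qed
  finally have total: "(\<Sum>j<300. f j) \<le> 234 * int (card (\<tau> ` Act))"
    by simp
  have "\<exists>j<300. 300 * f j \<le> 234 * int (card (\<tau> ` Act))"
  proof (rule ccontr)
    assume "\<not> ?thesis"
    then have "(\<Sum>j<300::nat. 234 * int (card (\<tau> ` Act))) < (\<Sum>j<300. 300 * f j)"
      by (intro sum_strict_mono) (auto simp: not_le lessThan_empty_iff)
    then show False
      using total unfolding sum_distrib_left[symmetric] by simp
  qed
  then show ?thesis
    using that unfolding f_def by blast
qed

text \<open>Equality holds up to size 6; from size 7 on the left side is negative.\<close>

lemma part_value: "0 < s \<Longrightarrow> 80820 - 12480 * int s \<le> (if s \<le> 6 then int s * weight s else 0)"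
proof (cases "s \<le> 6")
  case True
  assume "0 < s"
  with True have "s = 1 \<or> s = 2 \<or> s = 3 \<or> s = 4 \<or> s = 5 \<or> s = 6" by auto
  then show ?thesis by (auto simp: weight_def)
qed simp

text \<open>Divided by 80820, the coefficients are 1555/1347 per block and 208/1347 per element. As
  208 = 1555 - 1347, adding the number of terminals, which is at least the number of elements,
  yields the ratio.\<close>

theorem local_optimum_bound:
  assumes q: "7 * radius 300 \<le> q"
  shows "80820 * int (card (\<sigma> ` E)) \<le> 93300 * int (card (\<tau> ` E)) + 12480 * int (card E)"
proof -
  obtain j where j: "j < 300"
    "300 * (\<Sum>e\<in>Act. U (radius (Suc j)) e - U (radius j) e) \<le> 234 * int (card (\<tau> ` Act))"
    using small_step[OF q] .
  have "radius (Suc j) \<le> radius 300"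
    using j(1) by (intro radius_mono) simp
  then have n: "6 + 30 * radius j \<le> q"
    using q by simp
  have "(\<Sum>e\<in>Act. weight (size e)) \<le>
      92500 * int (card (\<tau> ` Act)) + 720 * (\<Sum>e\<in>Act. U (6 + 30 * radius j) e - U (radius j) e)"
    by (rule weight_sum_bound[OF radius_pos n])
  \<comment> \<open>The growth term is at most 720 * 234 / 300 < 562 per block, within the reserve
    of 800 between 92500 and 93300.\<close>
  then have "(\<Sum>e\<in>Act. weight (size e)) \<le> 93300 * int (card (\<tau> ` Act))"
    using j(2) by simp
  also have "card (\<tau> ` Act) \<le> card (\<tau> ` E)"
    using Act_E fin_E by (intro card_mono) auto
  finally have act: "(\<Sum>e\<in>Act. weight (size e)) \<le> 93300 * int (card (\<tau> ` E))"
    by simp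
  have cardE: "int (card E) = (\<Sum>v\<in>\<sigma> ` E. int (card (part v)))"
    using sum.image_gen[OF fin_E, of "\<lambda>_. 1::int" \<sigma>] by (simp add: fiber_def)
  have "80820 * int (card (\<sigma> ` E)) - 12480 * int (card E) = (\<Sum>v\<in>\<sigma> ` E. 80820 - 12480 * int (card (part v)))"
    by (simp add: cardE sum_subtractf sum_distrib_left)
  also have "\<dots> \<le> (\<Sum>v\<in>\<sigma> ` E. \<Sum>e\<in>{e \<in> E. \<sigma> e = v}. if size e \<le> 6 then weight (size e) else 0)"
  proof (rule sum_mono)
    fix v assume v: "v \<in> \<sigma> ` E"
    have "0 < card (part v)"
      using v fin_E by (auto simp: fiber_def card_gt_0_iff)
    moreover have "(\<Sum>e\<in>{e \<in> E. \<sigma> e = v}. if size e \<le> 6 then weight (size e) else 0) =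
        (\<Sum>e\<in>part v. if card (part v) \<le> 6 then weight (card (part v)) else 0)"
      by (intro sum.cong) (auto simp: size_def fiber_def)
    ultimately show "80820 - 12480 * int (card (part v)) \<le>
        (\<Sum>e\<in>{e \<in> E. \<sigma> e = v}. if size e \<le> 6 then weight (size e) else 0)"
      using part_value[of "card (part v)"] by (simp split: if_splits)
  qed
  also have "\<dots> = (\<Sum>e\<in>E. if size e \<le> 6 then weight (size e) else 0)"
    by (rule sum.image_gen[OF fin_E, symmetric])
  also have "\<dots> = (\<Sum>e\<in>Act. weight (size e))"
    using fin_E by (simp add: Act_def sum.inter_filter)
  finally show ?thesis
    using act by linarith
qed

end

subsection \<open>Total correctness with time bounds\<close>

definition runs :: "com \<Rightarrow> store \<Rightarrow> nat \<Rightarrow> (store \<Rightarrow> bool) \<Rightarrow> bool" where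
  "runs c s T Q \<longleftrightarrow> (\<exists>t s'. exec c s t s' \<and> t \<le> T \<and> Q s')"

lemma runs_conseq: "runs c s T Q \<Longrightarrow> (\<And>s'. Q s' \<Longrightarrow> Q' s') \<Longrightarrow> T \<le> T' \<Longrightarrow> runs c s T' Q'"
  unfolding runs_def by (meson order_trans)

lemma runs_Skip: "Q s \<Longrightarrow> 1 \<le> T \<Longrightarrow> runs Skip s T Q"
  unfolding runs_def using exec_Skip by blast

lemma runs_Put:
  "Q (s(x := (s x)(aval i s := aval a s))) \<Longrightarrow> 1 + acost i + acost a \<le> T \<Longrightarrow> runs (Put x i a) s T Q"
  unfolding runs_def using exec_Put by blast

lemma runs_Seq: "runs c s T1 (\<lambda>s'. runs d s' T2 Q) \<Longrightarrow> T1 + T2 \<le> T \<Longrightarrow> runs (Seq c d) s T Q"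
  unfolding runs_def by (meson add_mono exec_Seq order_trans)

lemma runs_Cond:
  assumes "bval b s \<Longrightarrow> runs c s T' Q" "\<not> bval b s \<Longrightarrow> runs d s T' Q" "bcost b + T' \<le> T"
  shows "runs (Cond b c d) s T Q"
proof (cases "bval b s")
  case True
  then obtain t s' where "exec c s t s'" "t \<le> T'" "Q s'"
    using assms(1) by (auto simp: runs_def)
  then show ?thesis
    using exec_CondT[OF True] assms(3) unfolding runs_def by (meson add_left_mono order_trans)
next
  case False
  then obtain t s' where "exec d s t s'" "t \<le> T'" "Q s'"
    using assms(2) by (auto simp: runs_def)
  then show ?thesis
    using exec_CondF[OF False] assms(3) unfolding runs_def by (meson add_left_mono order_trans)
qed

lemma runs_LoopF: "\<not> bval b s \<Longrightarrow> Q s \<Longrightarrow> bcost b \<le> T \<Longrightarrow> runs (Loop b c) s T Q"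
  unfolding runs_def using exec_LoopF by blast

lemma runs_LoopT:
  assumes "bval b s" "runs c s T1 (\<lambda>s'. runs (Loop b c) s' T2 Q)" "bcost b + T1 + T2 \<le> T"
  shows "runs (Loop b c) s T Q"
proof -
  obtain t s' t' s'' where "exec c s t s'" "t \<le> T1" "exec (Loop b c) s' t' s''" "t' \<le> T2" "Q s''"
    using assms(2) by (auto simp: runs_def)
  then have "exec (Loop b c) s (bcost b + t + t') s''" "bcost b + t + t' \<le> T"
    using exec_LoopT[OF assms(1)] assms(3) by auto
  then show ?thesis
    using \<open>Q s''\<close> unfolding runs_def by blast
qed

section \<open>Counted loops\<close>

definition reg :: "nat \<Rightarrow> aexp" where
  "reg k = Get 10 (Const k)"

definition For :: "nat \<Rightarrow> nat \<Rightarrow> com \<Rightarrow> com" where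
  "For k c body = Seq (Put 10 (Const k) (Const 0))
     (Loop (Less (reg k) (Get 0 (Const c))) (Seq body (Put 10 (Const k) (Plus (reg k) (Const 1)))))"

lemma aval_reg [simp]: "aval (reg k) s = s 10 k" and acost_reg [simp]: "acost (reg k) = 2"
  by (simp_all add: reg_def)

text \<open>The invariant is required after the counter has been advanced. Test and increment cost
  11 steps per round. The time bound refers to \<open>z\<close> instead of the number
  \<open>N\<close> of rounds, so that it becomes a polynomial in the instance size.\<close>

lemma runs_For:
  assumes N: "N \<le> z"
    and init: "I 0 (s(10 := (s 10)(k := 0)))"
    and bound: "\<And>i s. I i s \<Longrightarrow> s 0 c = N \<and> s 10 k = i"
    and step: "\<And>i s. i < N \<Longrightarrow> I i s \<Longrightarrow>
      runs body s T (\<lambda>s'. s' 10 k = i \<and> I (Suc i) (s'(10 := (s' 10)(k := Suc i))))"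
    and final: "\<And>s. I N s \<Longrightarrow> Q s"
    and T': "10 + z * (T + 12) \<le> T'"
  shows "runs (For k c body) s T' Q"
proof -
  let ?L = "Loop (Less (reg k) (Get 0 (Const c))) (Seq body (Put 10 (Const k) (Plus (reg k) (Const 1))))"
  have loop: "runs ?L s ((N - i) * (T + 12) + 5) Q" if "I i s" "i \<le> N" for i s
    using that
  proof (induction "N - i" arbitrary: i s)
    case 0
    then show ?case
      using bound[OF 0(2)] final by (intro runs_LoopF) auto
  next
    case (Suc r)
    then have "i < N" by simp
    have "runs body s T (\<lambda>s'. s' 10 k = i \<and> I (Suc i) (s'(10 := (s' 10)(k := Suc i))))"
      by (rule step[OF \<open>i < N\<close> Suc.prems(1)])
    then have "runs body s T (\<lambda>s'. runs (Put 10 (Const k) (Plus (reg k) (Const 1))) s' 6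
        (\<lambda>s''. runs ?L s'' ((N - Suc i) * (T + 12) + 5) Q))"
    proof (rule runs_conseq)
      fix s' assume "s' 10 k = i \<and> I (Suc i) (s'(10 := (s' 10)(k := Suc i)))"
      then show "runs (Put 10 (Const k) (Plus (reg k) (Const 1))) s' 6
          (\<lambda>s''. runs ?L s'' ((N - Suc i) * (T + 12) + 5) Q)"
        using Suc.hyps \<open>i < N\<close> by (intro runs_Put Suc.hyps(1)) auto
    qed simp
    then have "runs (Seq body (Put 10 (Const k) (Plus (reg k) (Const 1)))) s (T + 6)
        (\<lambda>s''. runs ?L s'' ((N - Suc i) * (T + 12) + 5) Q)"
      by (rule runs_Seq) simp
    moreover have "(N - i) * (T + 12) = (T + 12) + (N - Suc i) * (T + 12)"
      using \<open>i < N\<close> by (metis Suc_diff_Suc mult_Suc)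
    ultimately show ?case
      using bound[OF Suc.prems(1)] \<open>i < N\<close> by (intro runs_LoopT) auto
  qed
  have "3 + (N * (T + 12) + 5) \<le> T'"
    using mult_right_mono[OF N, of "T + 12"] T' by linarith
  then show ?thesis
    unfolding For_def using loop[OF init] by (intro runs_Seq[of _ _ 3] runs_Put) auto
qed

subsection \<open>The program\<close>

text \<open>
  Array 5 holds the current assignment, 6 the characteristic vector of the elements, 7 the candidate,
  8 the part sizes, 9 the marginals of the potential, 10 the loop counters. Array 11 holds the
  potentials of the current assignment, of the candidate, and of the assignment at the start of the
  current scan. A move is a sequence of \<open>q\<close> edges, stored in the counters \<open>1, \<dots>, q\<close>; repeated
  edges make up for moves of fewer elements.
\<close>

definition table_com :: com where
  "table_com = Seq (Put 9 (Const 0) (Const 110)) (Seq (Put 9 (Const 1) (Const 85))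
     (Seq (Put 9 (Const 2) (Const 80)) (Seq (Put 9 (Const 3) (Const 76))
     (Seq (Put 9 (Const 4) (Const 73)) (Put 9 (Const 5) (Const 71))))))"

definition copy_com :: "nat \<Rightarrow> nat \<Rightarrow> com" where
  "copy_com a b = For 0 0 (Put b (reg 0) (Get a (reg 0)))"

definition flag_com :: com where
  "flag_com = Seq (copy_com 3 6)
     (For 0 1 (Cond (Conj (Equal (Get 3 (Get 1 (reg 0))) (Const 1)) (Equal (Get 3 (Get 2 (reg 0))) (Const 1)))
       (Seq (Put 6 (Get 1 (reg 0)) (Const 0)) (Put 6 (Get 2 (reg 0)) (Const 0))) Skip))"

definition reassign_com :: "nat \<Rightarrow> nat \<Rightarrow> com" where
  "reassign_com a k = Cond (Equal (Get 6 (Get 1 (reg k))) (Const 1)) (Put a (Get 1 (reg k)) (Get 2 (reg k)))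
     (Cond (Equal (Get 6 (Get 2 (reg k))) (Const 1)) (Put a (Get 2 (reg k)) (Get 1 (reg k))) Skip)"

text \<open>An element that joins a part of current size \<open>i\<close> adds \<open>marg i\<close>
  to the potential. Array 9 is 0 from cell 6 on, in agreement with \<open>marg\<close>.\<close>

definition phi_com :: "nat \<Rightarrow> nat \<Rightarrow> com" where
  "phi_com a k = Seq (For 0 0 (Put 8 (reg 0) (Const 0))) (Seq (Put 11 (Const k) (Const 0))
     (For 0 0 (Cond (Equal (Get 6 (reg 0)) (Const 1))
       (Seq (Put 11 (Const k) (Plus (Get 11 (Const k)) (Get 9 (Get 8 (Get a (reg 0))))))
            (Put 8 (Get a (reg 0)) (Plus (Get 8 (Get a (reg 0))) (Const 1)))) Skip)))"

primrec reassign_all_com :: "nat \<Rightarrow> com" where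
  "reassign_all_com 0 = Skip"
| "reassign_all_com (Suc i) = Seq (reassign_all_com i) (reassign_com 7 (Suc i))"

definition try_com :: "nat \<Rightarrow> com" where
  "try_com q = Seq (copy_com 5 7) (Seq (reassign_all_com q) (Seq (phi_com 7 1)
     (Cond (Less (Get 11 (Const 1)) (Get 11 (Const 0)))
       (Seq (copy_com 7 5) (Put 11 (Const 0) (Get 11 (Const 1)))) Skip)))"

text \<open>The recursion produces \<open>q\<close> nested loops, with counters \<open>q\<close>
  (outermost) to 1, which try all sequences of \<open>q\<close> edges. An improvement is accepted at
  once and the scan continues from it.\<close>

primrec scan_com :: "nat \<Rightarrow> nat \<Rightarrow> com" where
  "scan_com q 0 = try_com q"
| "scan_com q (Suc i) = For (Suc i) 1 (scan_com q i)"

text \<open>The loop ends once a complete scan has not lowered the potential. Before it,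
  \<open>cover_com\<close> sets cell 2 to one more than cell 0, which forces a first scan.\<close>

definition search_com :: "nat \<Rightarrow> com" where
  "search_com q = Loop (Less (Get 11 (Const 0)) (Get 11 (Const 2)))
     (Seq (Put 11 (Const 2) (Get 11 (Const 0))) (scan_com q q))"

definition output_com :: com where
  "output_com = Seq (copy_com 3 4)
     (For 0 0 (Cond (Equal (Get 6 (reg 0)) (Const 1)) (Put 4 (Get 5 (reg 0)) (Const 1)) Skip))"

definition cover_com :: "nat \<Rightarrow> com" where
  "cover_com q = Seq table_com (Seq flag_com (Seq (For 0 1 (reassign_com 5 0)) (Seq (phi_com 5 0)
     (Seq (Put 11 (Const 2) (Plus (Get 11 (Const 0)) (Const 1))) (Seq (search_com q) output_com)))))"

section \<open>Running times\<close>

definition copy_time :: "nat \<Rightarrow> nat" where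
  "copy_time z = 10 + z * 18"

definition flag_time :: "nat \<Rightarrow> nat" where
  "flag_time z = copy_time z + (10 + z * 36)"

definition phi_time :: "nat \<Rightarrow> nat" where
  "phi_time z = (10 + z * 16) + (3 + (10 + z * 42))"

definition output_time :: "nat \<Rightarrow> nat" where
  "output_time z = copy_time z + (10 + z * 30)"

definition try_time :: "nat \<Rightarrow> nat \<Rightarrow> nat" where
  "try_time z q = copy_time z + (1 + 22 * q + (phi_time z + (10 + (copy_time z + 5))))"

primrec scan_time :: "nat \<Rightarrow> nat \<Rightarrow> nat \<Rightarrow> nat" where
  "scan_time z q 0 = try_time z q"
| "scan_time z q (Suc i) = 10 + z * (scan_time z q i + 12)"

text \<open>Every scan but the last lowers the potential, a natural number of at most
  \<open>495 * z\<close>; this explains the factor \<open>495 * z + 1\<close>.\<close>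

definition total_time :: "nat \<Rightarrow> nat \<Rightarrow> nat" where
  "total_time z q = 18 + (flag_time z + ((10 + z * 34) + (phi_time z + (6 +
     ((5 + (495 * z + 1) * (scan_time z q q + 20)) + output_time z)))))"

subsection \<open>Correctness of the program\<close>

locale graph_data =
  fixes n m :: nat and A B T :: "nat \<Rightarrow> nat" and z :: nat
  assumes A_less: "j < m \<Longrightarrow> A j < n" and B_less: "j < m \<Longrightarrow> B j < n"
    and T_le: "T v \<le> 1" and T_outside: "n \<le> v \<Longrightarrow> T v = 0"
    and n_le: "n \<le> z" and m_le: "m \<le> z"
begin

definition elem :: "nat \<Rightarrow> bool" where
  "elem v \<longleftrightarrow> v < n \<and> T v = 1 \<and> (\<forall>j<m. T (A j) = 1 \<and> T (B j) = 1 \<longrightarrow> v \<noteq> A j \<and> v \<noteq> B j)"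

definition reassign :: "(nat \<Rightarrow> nat) \<Rightarrow> nat \<Rightarrow> (nat \<Rightarrow> nat)" where
  "reassign \<sigma> j = (if elem (A j) then \<sigma>(A j := B j) else if elem (B j) then \<sigma>(B j := A j) else \<sigma>)"

definition Phi :: "(nat \<Rightarrow> nat) \<Rightarrow> nat" where
  "Phi \<sigma> = (\<Sum>c<n. pot (card (fiber {v. elem v} \<sigma> c)))"

text \<open>Cells from \<open>n\<close> on are fixed to 0 because copying between arrays 5 and 7
  reaches the first \<open>n\<close> cells only.\<close>

definition well :: "(nat \<Rightarrow> nat) \<Rightarrow> bool" where
  "well \<sigma> \<longleftrightarrow> (\<forall>v\<ge>n. \<sigma> v = 0) \<and> (\<forall>v. elem v \<longrightarrow> \<sigma> v < n)"

definition linked :: "(nat \<Rightarrow> nat) \<Rightarrow> nat \<Rightarrow> bool" where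
  "linked \<sigma> v \<longleftrightarrow> (\<exists>j<m. (v = A j \<and> \<sigma> v = B j) \<or> (v = B j \<and> \<sigma> v = A j))"

text \<open>Elements that lie on no edge occur only in infeasible instances, on which the program
  still has to halt in time. They keep the default value 0.\<close>

definition touched :: "nat \<Rightarrow> nat \<Rightarrow> bool" where
  "touched i v \<longleftrightarrow> (\<exists>j<i. v = A j \<or> v = B j)"

lemma elem_less: "elem v \<Longrightarrow> v < n"
  by (simp add: elem_def)

lemma elem_not_both: "j < m \<Longrightarrow> elem (A j) \<Longrightarrow> elem (B j) \<Longrightarrow> False"
  by (auto simp: elem_def)

lemma well_reassign: "well \<sigma> \<Longrightarrow> j < m \<Longrightarrow> well (reassign \<sigma> j)"
  using A_less[of j] B_less[of j] by (auto simp: well_def reassign_def)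

lemma linked_reassign: "linked \<sigma> v \<Longrightarrow> j < m \<Longrightarrow> linked (reassign \<sigma> j) v"
  by (auto simp: linked_def reassign_def)

lemma linked_reassign_new: "j < m \<Longrightarrow> elem v \<Longrightarrow> v = A j \<or> v = B j \<Longrightarrow> linked (reassign \<sigma> j) v"
  using elem_not_both[of j] by (auto simp: linked_def reassign_def)

definition ctx :: "store \<Rightarrow> bool" where
  "ctx s \<longleftrightarrow> s 0 0 = n \<and> s 0 1 = m \<and> s 1 = A \<and> s 2 = B \<and> s 3 = T"

definition env :: "store \<Rightarrow> bool" where
  "env s \<longleftrightarrow> ctx s \<and> s 6 = (\<lambda>v. if elem v then 1 else 0) \<and> s 9 = marg \<and> s 4 = (\<lambda>_. 0)"

lemma runs_table:
  assumes "s 9 = (\<lambda>_. 0)"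
  shows "runs table_com s 18 (\<lambda>s'. s' = s(9 := marg))"
proof -
  have "(\<lambda>_. 0)(0 := 110, Suc 0 := 85, 2 := 80, 3 := 76, 4 := 73, 5 := 71) = marg"
  proof
    fix i :: nat
    show "((\<lambda>_. 0)(0 := 110, Suc 0 := 85, 2 := 80, 3 := 76, 4 := 73, 5 := 71)) i = marg i"
      using less_6_cases[of i] by (cases "i < 6") auto
  qed
  then show ?thesis
    unfolding table_com_def using assms
    by (intro runs_Seq[where ?T1.0 = 3] runs_Put) auto
qed

lemma runs_copy:
  assumes "s 0 0 = n" "a \<noteq> b" "a \<noteq> 10" "b \<noteq> 10" "b \<noteq> 0" "\<And>v. n \<le> v \<Longrightarrow> s b v = s a v"
  shows "runs (copy_com a b) s (copy_time z)
    (\<lambda>s'. s' b = s a \<and> (\<forall>x. x \<notin> {b, 10} \<longrightarrow> s' x = s x) \<and> (\<forall>k. k \<noteq> 0 \<longrightarrow> s' 10 k = s 10 k))"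
proof -
  let ?I = "\<lambda>i s'. (\<forall>x. x \<notin> {b, 10} \<longrightarrow> s' x = s x) \<and> (\<forall>k. k \<noteq> 0 \<longrightarrow> s' 10 k = s 10 k) \<and>
    s' 10 0 = i \<and> (\<forall>v. v < i \<or> n \<le> v \<longrightarrow> s' b v = s a v)"
  show ?thesis
    unfolding copy_com_def
  proof (rule runs_For[where I = ?I and N = n and T = 6])
    show "runs (Put b (reg 0) (Get a (reg 0))) s' 6
        (\<lambda>s'. s' 10 0 = i \<and> ?I (Suc i) (s'(10 := (s' 10)(0 := Suc i))))" if "i < n" "?I i s'" for i s'
      using that assms by (intro runs_Put) (auto simp: less_Suc_eq)
    show "?I n s' \<Longrightarrow> s' b = s a \<and> (\<forall>x. x \<notin> {b, 10} \<longrightarrow> s' x = s x) \<and> (\<forall>k. k \<noteq> 0 \<longrightarrow> s' 10 k = s 10 k)" for s'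
      by (auto simp: fun_eq_iff not_less)
  qed (use assms n_le in \<open>auto simp: copy_time_def\<close>)
qed

lemma runs_flag:
  assumes "ctx s" "s 6 = (\<lambda>_. 0)"
  shows "runs flag_com s (flag_time z) (\<lambda>s'. s' 6 = (\<lambda>v. if elem v then 1 else 0) \<and>
    (\<forall>x. x \<notin> {6, 10} \<longrightarrow> s' x = s x))"
proof -
  let ?I = "\<lambda>i s'. (\<forall>x. x \<notin> {6, 10} \<longrightarrow> s' x = s x) \<and> s' 10 0 = i \<and>
    (\<forall>v. s' 6 v = (if \<exists>j<i. T (A j) = 1 \<and> T (B j) = 1 \<and> (v = A j \<or> v = B j) then 0 else T v))"
  show ?thesis
    unfolding flag_com_def
  proof (rule runs_Seq[OF runs_conseq[OF runs_copy]])
    fix s' assume s': "s' 6 = s 3 \<and> (\<forall>x. x \<notin> {6, 10} \<longrightarrow> s' x = s x) \<and> (\<forall>k. k \<noteq> 0 \<longrightarrow> s' 10 k = s 10 k)"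
    show "runs (For 0 1 (Cond (Conj (Equal (Get 3 (Get 1 (reg 0))) (Const 1)) (Equal (Get 3 (Get 2 (reg 0))) (Const 1)))
       (Seq (Put 6 (Get 1 (reg 0)) (Const 0)) (Put 6 (Get 2 (reg 0)) (Const 0))) Skip)) s' (10 + z * 36)
       (\<lambda>s'. s' 6 = (\<lambda>v. if elem v then 1 else 0) \<and> (\<forall>x. x \<notin> {6, 10} \<longrightarrow> s' x = s x))"
    proof (rule runs_For[where I = ?I and N = m and T = 24])
      fix i t assume i: "i < m" and t: "?I i t"
      have eqs: "t 1 = A" "t 2 = B" "t 3 = T"
        using t assms(1) by (auto simp: ctx_def)
      show "runs (Cond (Conj (Equal (Get 3 (Get 1 (reg 0))) (Const 1)) (Equal (Get 3 (Get 2 (reg 0))) (Const 1)))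
         (Seq (Put 6 (Get 1 (reg 0)) (Const 0)) (Put 6 (Get 2 (reg 0)) (Const 0))) Skip) t 24
         (\<lambda>t'. t' 10 0 = i \<and> ?I (Suc i) (t'(10 := (t' 10)(0 := Suc i))))"
        using t eqs by (intro runs_Cond[where T' = 11] runs_Seq[where ?T1.0 = 5 and ?T2.0 = 5] runs_Put runs_Skip)
          (auto simp: less_Suc_eq)
    next
      fix t assume t: "?I m t"
      have "t 6 v = (if elem v then 1 else 0)" for v
        using t T_le[of v] T_outside[of v] by (cases "T v = 0"; cases "v < n") (auto simp: elem_def)
      then show "t 6 = (\<lambda>v. if elem v then 1 else 0) \<and> (\<forall>x. x \<notin> {6, 10} \<longrightarrow> t x = s x)"
        using t by auto
    qed (use s' assms m_le in \<open>auto simp: ctx_def\<close>)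
  qed (use assms T_outside in \<open>auto simp: ctx_def flag_time_def\<close>)
qed

lemma runs_reassign:
  assumes "env s" "a \<notin> {0, 1, 2, 3, 4, 6, 9, 10}"
  shows "runs (reassign_com a k) s 22 (\<lambda>s'. s' = s(a := reassign (s a) (s 10 k)))"
  using assms unfolding reassign_com_def env_def ctx_def reassign_def
  by (intro runs_Cond[where T' = 15] runs_Cond[where T' = 8] runs_Put runs_Skip) auto

lemma runs_phi:
  assumes s: "env s" and a: "a \<notin> {0, 1, 2, 3, 4, 6, 8, 9, 10, 11}" and less: "\<And>v. elem v \<Longrightarrow> s a v < n"
  shows "runs (phi_com a k) s (phi_time z) (\<lambda>s'. s' 11 = (s 11)(k := Phi (s a)) \<and>
    (\<forall>x. x \<notin> {8, 10, 11} \<longrightarrow> s' x = s x) \<and> (\<forall>k. k \<noteq> 0 \<longrightarrow> s' 10 k = s 10 k))"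
proof -
  have ctx: "s 0 0 = n" "s 6 = (\<lambda>v. if elem v then 1 else 0)" "s 9 = marg"
    using s by (auto simp: env_def ctx_def)
  let ?D = "\<lambda>i. fiber {v. elem v \<and> v < i} (s a)"
  let ?F = "\<lambda>s'. (\<forall>x. x \<notin> {8, 10, 11} \<longrightarrow> s' x = s x) \<and> (\<forall>k. k \<noteq> 0 \<longrightarrow> s' 10 k = s 10 k)"
  let ?I = "\<lambda>i s'. ?F s' \<and> s' 10 0 = i \<and> s' 11 = s 11 \<and> (\<forall>v<i. s' 8 v = 0)"
  let ?J = "\<lambda>i s'. ?F s' \<and> s' 10 0 = i \<and> s' 11 = (s 11)(k := (\<Sum>c<n. pot (card (?D i c)))) \<and>
    (\<forall>c<n. s' 8 c = card (?D i c))"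
  have D_step: "?D (Suc i) c = (if elem i \<and> s a i = c then insert i (?D i c) else ?D i c)" for i c
    by (auto simp: fiber_def less_Suc_eq)
  have fin: "finite (?D i c)" and notin: "i \<notin> ?D i c" for i c
    by (auto simp: fiber_def intro: finite_subset[of _ "{..<i}"])
  have zero: "runs (For 0 0 (Put 8 (reg 0) (Const 0))) s (10 + z * 16) (?I n)"
  proof (rule runs_For[where I = ?I and N = n and T = 4])
    show "runs (Put 8 (reg 0) (Const 0)) s' 4
        (\<lambda>s'. s' 10 0 = i \<and> ?I (Suc i) (s'(10 := (s' 10)(0 := Suc i))))" if "i < n" "?I i s'" for i s'
      using that by (intro runs_Put) (auto simp: less_Suc_eq)
  qed (use ctx n_le in auto)
  have main: "runs (For 0 0 (Cond (Equal (Get 6 (reg 0)) (Const 1))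
       (Seq (Put 11 (Const k) (Plus (Get 11 (Const k)) (Get 9 (Get 8 (Get a (reg 0))))))
            (Put 8 (Get a (reg 0)) (Plus (Get 8 (Get a (reg 0))) (Const 1)))) Skip)) t (10 + z * 42) (?J n)"
    if t: "?F t" "t 11 = (s 11)(k := 0)" "\<forall>v<n. t 8 v = 0" for t
  proof (rule runs_For[where I = ?J and N = n and T = 30])
    have "?D 0 c = {}" for c
      by (auto simp: fiber_def)
    then show "?J 0 (t(10 := (t 10)(0 := 0)))"
      using t by auto
    show "runs (Cond (Equal (Get 6 (reg 0)) (Const 1))
       (Seq (Put 11 (Const k) (Plus (Get 11 (Const k)) (Get 9 (Get 8 (Get a (reg 0))))))
            (Put 8 (Get a (reg 0)) (Plus (Get 8 (Get a (reg 0))) (Const 1)))) Skip) s' 30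
        (\<lambda>s'. s' 10 0 = i \<and> ?J (Suc i) (s'(10 := (s' 10)(0 := Suc i))))" if i: "i < n" and s': "?J i s'" for i s'
    proof (cases "elem i")
      case True
      have eqs: "s' 6 = (\<lambda>v. if elem v then 1 else 0)" "s' 9 = marg" "s' a = s a"
        using s' ctx a by auto
      have "pot (card (?D (Suc i) c)) = pot (card (?D i c)) + (if c = s a i then marg (card (?D i c)) else 0)" for c
        using True by (simp add: D_step pot_Suc fin notin)
      then have sum: "(\<Sum>c<n. pot (card (?D (Suc i) c))) =
          (\<Sum>c<n. pot (card (?D i c))) + marg (card (?D i (s a i)))"
        using less[OF True] by (simp add: sum.distrib)
      have card: "card (?D (Suc i) c) = (if c = s a i then Suc (card (?D i c)) else card (?D i c))" for c
        using True by (simp add: D_step fin notin)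
      show ?thesis
        using s' eqs True less[OF True] a
        by (intro runs_Cond[where T' = 25] runs_Seq[where ?T1.0 = 11 and ?T2.0 = 14] runs_Put)
          (simp_all add: sum[unfolded card] card)
    next
      case False
      have "s' 6 i = 0"
        using s' ctx False by simp
      moreover have "?D (Suc i) = ?D i"
        using False by (simp add: D_step fun_eq_iff)
      ultimately show ?thesis
        using s' by (intro runs_Cond[where T' = 25] runs_Skip) auto
    qed
  qed (use ctx n_le in auto)
  have final: "?D n = fiber {v. elem v} (s a)"
    using elem_less by (auto simp: fiber_def fun_eq_iff)
  show ?thesis
    unfolding phi_com_def phi_time_def
  proof (rule runs_Seq[where ?T1.0 = "10 + z * 16", OF runs_conseq[OF zero]])
    fix t assume t: "?I n t"
    show "runs (Seq (Put 11 (Const k) (Const 0)) (For 0 0 (Cond (Equal (Get 6 (reg 0)) (Const 1))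
       (Seq (Put 11 (Const k) (Plus (Get 11 (Const k)) (Get 9 (Get 8 (Get a (reg 0))))))
            (Put 8 (Get a (reg 0)) (Plus (Get 8 (Get a (reg 0))) (Const 1)))) Skip))) t (3 + (10 + z * 42))
       (\<lambda>s'. s' 11 = (s 11)(k := Phi (s a)) \<and>
    (\<forall>x. x \<notin> {8, 10, 11} \<longrightarrow> s' x = s x) \<and> (\<forall>k. k \<noteq> 0 \<longrightarrow> s' 10 k = s 10 k))"
    proof (rule runs_Seq[where ?T1.0 = 3, OF runs_Put])
      show "runs (For 0 0 (Cond (Equal (Get 6 (reg 0)) (Const 1))
       (Seq (Put 11 (Const k) (Plus (Get 11 (Const k)) (Get 9 (Get 8 (Get a (reg 0))))))
            (Put 8 (Get a (reg 0)) (Plus (Get 8 (Get a (reg 0))) (Const 1)))) Skip))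
         (t(11 := (t 11)(aval (Const k) t := aval (Const 0) t))) (10 + z * 42)
       (\<lambda>s'. s' 11 = (s 11)(k := Phi (s a)) \<and>
    (\<forall>x. x \<notin> {8, 10, 11} \<longrightarrow> s' x = s x) \<and> (\<forall>k. k \<noteq> 0 \<longrightarrow> s' 10 k = s 10 k))"
        by (rule runs_conseq[OF main]) (use t in \<open>auto simp: final Phi_def\<close>)
    qed simp_all
  qed simp_all
qed

section \<open>Correctness of the local search\<close>

definition good :: "store \<Rightarrow> bool" where
  "good s \<longleftrightarrow> env s \<and> well (s 5) \<and> (\<forall>v\<ge>n. s 7 v = 0) \<and> s 11 0 = Phi (s 5) \<and>
     (\<forall>v. elem v \<and> touched m v \<longrightarrow> linked (s 5) v)"

lemma env_upd: "env s \<Longrightarrow> (\<And>x. x \<in> {0, 1, 2, 3, 4, 6, 9} \<Longrightarrow> s' x = s x) \<Longrightarrow> env s'"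
  by (simp add: env_def ctx_def)

lemma runs_reassign_all:
  assumes "env s" "\<And>k. k \<in> {1..i} \<Longrightarrow> s 10 k < m"
  shows "runs (reassign_all_com i) s (1 + 22 * i)
    (\<lambda>s'. s' = s(7 := foldl reassign (s 7) (map (s 10) [1..<Suc i])))"
  using assms
proof (induction i)
  case 0
  then show ?case by (auto intro!: runs_Skip)
next
  case (Suc i)
  show ?case
    unfolding reassign_all_com.simps
  proof (rule runs_Seq[OF runs_conseq[OF Suc.IH]])
    fix s' assume s': "s' = s(7 := foldl reassign (s 7) (map (s 10) [1..<Suc i]))"
    then have "env s'"
      using Suc.prems(1) by (auto elim!: env_upd)
    then show "runs (reassign_com 7 (Suc i)) s' 22
        (\<lambda>s'. s' = s(7 := foldl reassign (s 7) (map (s 10) [1..<Suc (Suc i)])))"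
      by (rule runs_conseq[OF runs_reassign]) (use s' in auto)
  qed (use Suc.prems in auto)
qed

lemma well_foldl: "well \<sigma> \<Longrightarrow> set js \<subseteq> {..<m} \<Longrightarrow> well (foldl reassign \<sigma> js)"
  by (induction js arbitrary: \<sigma>) (auto intro: well_reassign)

lemma linked_foldl: "linked \<sigma> v \<Longrightarrow> set js \<subseteq> {..<m} \<Longrightarrow> linked (foldl reassign \<sigma> js) v"
  by (induction js arbitrary: \<sigma>) (auto intro: linked_reassign)

text \<open>\<open>i\<close> is the largest counter that may change and \<open>J\<close> the set of
  sequences tried. Accepted changes lower the potential strictly, so an unchanged potential means
  that all of \<open>J\<close> was tested against one and the same assignment.\<close>

definition progress :: "nat \<Rightarrow> nat list set \<Rightarrow> store \<Rightarrow> store \<Rightarrow> bool" where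
  "progress i J s s' \<longleftrightarrow> good s' \<and> s' 11 2 = s 11 2 \<and> (\<forall>k>i. s' 10 k = s 10 k) \<and> Phi (s' 5) \<le> Phi (s 5) \<and>
     (Phi (s' 5) = Phi (s 5) \<longrightarrow> s' 5 = s 5 \<and> (\<forall>js\<in>J. Phi (s 5) \<le> Phi (foldl reassign (s 5) js)))"

lemma runs_try:
  assumes s: "good s" and k: "\<And>k. k \<in> {1..q} \<Longrightarrow> s 10 k < m"
  shows "runs (try_com q) s (try_time z q) (progress 0 {map (s 10) [1..<Suc q]} s)"
proof -
  define js where "js = map (s 10) [1..<Suc q]"
  let ?\<sigma> = "foldl reassign (s 5) js"
  have js: "set js \<subseteq> {..<m}"
    using k by (auto simp: js_def)
  have env: "env s" and well: "well (s 5)"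
    using s by (auto simp: good_def)
  have well': "well ?\<sigma>"
    by (rule well_foldl[OF well js])
  show ?thesis
    unfolding try_com_def try_time_def js_def[symmetric]
  proof (rule runs_Seq[OF runs_conseq[OF runs_copy]])
    fix s1 assume s1: "s1 7 = s 5 \<and> (\<forall>x. x \<notin> {7, 10} \<longrightarrow> s1 x = s x) \<and> (\<forall>k. k \<noteq> 0 \<longrightarrow> s1 10 k = s 10 k)"
    have env1: "env s1"
      using env by (rule env_upd) (use s1 in auto)
    have js1: "map (s1 10) [1..<Suc q] = js"
      unfolding js_def using s1 by (intro map_cong) auto
    show "runs (Seq (reassign_all_com q) (Seq (phi_com 7 1)
        (Cond (Less (Get 11 (Const 1)) (Get 11 (Const 0)))
          (Seq (copy_com 7 5) (Put 11 (Const 0) (Get 11 (Const 1)))) Skip))) s1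
        (1 + 22 * q + (phi_time z + (10 + (copy_time z + 5)))) (progress 0 {js} s)"
    proof (rule runs_Seq[OF runs_conseq[OF runs_reassign_all[OF env1]]])
      fix s2 assume "s2 = s1(7 := foldl reassign (s1 7) (map (s1 10) [1..<Suc q]))"
      then have "s2 = s1(7 := foldl reassign (s1 7) js)"
        unfolding js1 .
      then have s2: "s2 7 = ?\<sigma>" "\<And>x. x \<notin> {7, 10} \<Longrightarrow> s2 x = s x" "\<And>k. k \<noteq> 0 \<Longrightarrow> s2 10 k = s 10 k"
        using s1 by auto
      have env2: "env s2"
        using env by (rule env_upd) (use s2 in auto)
      show "runs (Seq (phi_com 7 1) (Cond (Less (Get 11 (Const 1)) (Get 11 (Const 0)))
          (Seq (copy_com 7 5) (Put 11 (Const 0) (Get 11 (Const 1)))) Skip)) s2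
        (phi_time z + (10 + (copy_time z + 5))) (progress 0 {js} s)"
      proof (rule runs_Seq[OF runs_conseq[OF runs_phi[OF env2]]])
        fix s3 assume "s3 11 = (s2 11)(1 := Phi (s2 7)) \<and> (\<forall>x. x \<notin> {8, 10, 11} \<longrightarrow> s3 x = s2 x) \<and>
          (\<forall>k. k \<noteq> 0 \<longrightarrow> s3 10 k = s2 10 k)"
        then have s3: "s3 7 = ?\<sigma>" "s3 11 = (s 11)(1 := Phi ?\<sigma>)"
          "\<And>x. x \<notin> {7, 8, 10, 11} \<Longrightarrow> s3 x = s x" "\<And>k. k \<noteq> 0 \<Longrightarrow> s3 10 k = s 10 k"
          using s2 by auto
        have env3: "env s3"
          using env by (rule env_upd) (use s3 in auto)
        have out3: "\<forall>v\<ge>n. s3 7 v = 0"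
          using s3 well' by (auto simp: well_def)
        show "runs (Cond (Less (Get 11 (Const 1)) (Get 11 (Const 0)))
            (Seq (copy_com 7 5) (Put 11 (Const 0) (Get 11 (Const 1)))) Skip) s3
          (10 + (copy_time z + 5)) (progress 0 {js} s)"
        proof (rule runs_Cond)
          assume "bval (Less (Get 11 (Const 1)) (Get 11 (Const 0))) s3"
          then have less: "Phi ?\<sigma> < Phi (s 5)"
            using s3 s by (simp add: good_def)
          show "runs (Seq (copy_com 7 5) (Put 11 (Const 0) (Get 11 (Const 1)))) s3 (copy_time z + 5) (progress 0 {js} s)"
          proof (rule runs_Seq[OF runs_conseq[OF runs_copy]])
            fix s4 assume s4: "s4 5 = s3 7 \<and> (\<forall>x. x \<notin> {5, 10} \<longrightarrow> s4 x = s3 x) \<and> (\<forall>k. k \<noteq> 0 \<longrightarrow> s4 10 k = s3 10 k)"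
            have env4: "env s4"
              using env3 by (rule env_upd) (use s4 in auto)
            have "good (s4(11 := (s4 11)(0 := s4 11 1)))"
              using env4 s3 s4 well' out3 s linked_foldl[OF _ js] by (auto simp: good_def elim!: env_upd)
            then show "runs (Put 11 (Const 0) (Get 11 (Const 1))) s4 5 (progress 0 {js} s)"
              using s3 s4 less by (intro runs_Put) (auto simp: progress_def)
          qed (use env3 well out3 s3 in \<open>auto simp: env_def ctx_def well_def\<close>)
        next
          assume "\<not> bval (Less (Get 11 (Const 1)) (Get 11 (Const 0))) s3"
          then have "Phi (s 5) \<le> Phi ?\<sigma>"
            using s3 s by (simp add: good_def)
          moreover have "good s3"
            using env3 s3 out3 s by (auto simp: good_def)
          ultimately show "runs Skip s3 (copy_time z + 5) (progress 0 {js} s)"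
            using s3 by (intro runs_Skip) (auto simp: progress_def)
        qed simp
      qed (use s2 well' in \<open>auto simp: well_def\<close>)
    qed (use s1 k in auto)
  qed (use env s in \<open>auto simp: env_def ctx_def good_def well_def\<close>)
qed

definition suffix :: "nat \<Rightarrow> nat \<Rightarrow> store \<Rightarrow> nat list" where
  "suffix q i s = map (s 10) [Suc i..<Suc q]"

lemma suffix_step: "i < q \<Longrightarrow> suffix q i s = s 10 (Suc i) # suffix q (Suc i) s"
  by (simp add: suffix_def upt_conv_Cons del: upt_Suc)

lemma runs_scan:
  assumes "i \<le> q" "good s" "\<And>k. i < k \<Longrightarrow> k \<le> q \<Longrightarrow> s 10 k < m"
  shows "runs (scan_com q i) s (scan_time z q i)
    (progress i {js @ suffix q i s | js. length js = i \<and> set js \<subseteq> {..<m}} s)"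
  using assms
proof (induction i arbitrary: s)
  case 0
  have "{js @ suffix q 0 s | js. length js = 0 \<and> set js \<subseteq> {..<m}} = {map (s 10) [1..<Suc q]}"
    by (auto simp: suffix_def simp del: upt_Suc)
  then show ?case
    using runs_try[of s q] 0 by simp
next
  case (Suc i)
  \<comment> \<open>The sequences tried in the first \<open>x\<close> rounds: entry number
    \<open>i + 1\<close> is less than \<open>x\<close>, the later ones are fixed by the outer
    counters.\<close>
  let ?J = "\<lambda>x. {js @ y # suffix q (Suc i) s | js y. y < x \<and> length js = i \<and> set js \<subseteq> {..<m}}"
  have J: "{js @ suffix q (Suc i) s | js. length js = Suc i \<and> set js \<subseteq> {..<m}} = ?J m"
  proof (intro equalityI subsetI)
    fix ks assume "ks \<in> {js @ suffix q (Suc i) s | js. length js = Suc i \<and> set js \<subseteq> {..<m}}"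
    then obtain js where js: "ks = js @ suffix q (Suc i) s" "length js = Suc i" "set js \<subseteq> {..<m}" by auto
    then have "js \<noteq> []" by auto
    then have "js = butlast js @ [last js]" by simp
    moreover have "last js < m" "set (butlast js) \<subseteq> {..<m}" "length (butlast js) = i"
      using js \<open>js \<noteq> []\<close> subsetD[OF js(3) last_in_set[of js]] by (auto dest: in_set_butlastD)
    ultimately show "ks \<in> ?J m"
      using js(1) by (metis (mono_tags, lifting) append.assoc append_Cons append_Nil mem_Collect_eq)
  next
    fix ks assume "ks \<in> ?J m"
    then obtain js y where "ks = (js @ [y]) @ suffix q (Suc i) s" "y < m" "length js = i" "set js \<subseteq> {..<m}" by auto
    then show "ks \<in> {js @ suffix q (Suc i) s | js. length js = Suc i \<and> set js \<subseteq> {..<m}}"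
      by (intro CollectI exI[of _ "js @ [y]"]) auto
  qed
  let ?I = "\<lambda>x s'. progress (Suc i) (?J x) s s' \<and> s' 10 (Suc i) = x"
  have good10: "good (t(10 := r)) \<longleftrightarrow> good t" for t r
    by (auto simp: good_def env_def ctx_def)
  show ?case
    unfolding J scan_com.simps scan_time.simps
  proof (rule runs_For[where I = ?I and N = m and T = "scan_time z q i"])
    show "?I 0 (s(10 := (s 10)(Suc i := 0)))"
      using Suc.prems(2) by (auto simp: progress_def good10)
    show "\<And>x t. ?I x t \<Longrightarrow> t 0 1 = m \<and> t 10 (Suc i) = x"
      by (auto simp: progress_def good_def env_def ctx_def)
    fix x t assume x: "x < m" and t: "?I x t"
    have counters: "\<And>k. Suc i < k \<Longrightarrow> t 10 k = s 10 k" and t_good: "good t"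
      using t by (auto simp: progress_def)
    have suff: "suffix q i t = x # suffix q (Suc i) s"
      using suffix_step[of i q t] Suc.prems(1) t counters by (auto simp: suffix_def simp del: upt_Suc)
    have bound: "t 10 k < m" if "i < k" "k \<le> q" for k
      using that t x counters[of k] Suc.prems(3)[of k] by (cases "k = Suc i") auto
    show "runs (scan_com q i) t (scan_time z q i)
        (\<lambda>t'. t' 10 (Suc i) = x \<and> ?I (Suc x) (t'(10 := (t' 10)(Suc i := Suc x))))"
    proof (rule runs_conseq[OF Suc.IH[OF _ t_good bound]])
      fix t' assume t': "progress i {js @ suffix q i t | js. length js = i \<and> set js \<subseteq> {..<m}} t t'"
      \<comment> \<open>If the final potential equals the initial one, neither the earlier rounds
        nor this one changed the assignment, so all their tests refer to \<open>s 5\<close>.\<close>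
      have "Phi (s 5) \<le> Phi (foldl reassign (s 5) ks)"
        if same: "Phi (t' 5) = Phi (s 5)" and ks_in: "ks \<in> ?J (Suc x)" for ks
      proof -
        have eq: "Phi (t 5) = Phi (s 5)" "Phi (t' 5) = Phi (t 5)"
          using t t' same by (auto simp: progress_def)
        then have "t 5 = s 5" and old: "\<forall>ks\<in>?J x. Phi (s 5) \<le> Phi (foldl reassign (s 5) ks)"
          using t by (auto simp: progress_def)
        obtain js y where ks: "ks = js @ y # suffix q (Suc i) s" "y < Suc x" "length js = i" "set js \<subseteq> {..<m}"
          using ks_in by auto
        show ?thesis
        proof (cases "y = x")
          case True
          then have "ks \<in> {js @ suffix q i t | js. length js = i \<and> set js \<subseteq> {..<m}}"
            using ks suff by auto
          then show ?thesis
            using t' eq \<open>t 5 = s 5\<close> by (auto simp: progress_def)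
        next
          case False
          then have "ks \<in> ?J x" using ks by auto
          then show ?thesis using old by blast
        qed
      qed
      then show "t' 10 (Suc i) = x \<and> ?I (Suc x) (t'(10 := (t' 10)(Suc i := Suc x)))"
        using t t' by (auto simp: progress_def good10)
    qed (use Suc.prems in auto)
  qed (use m_le in auto)
qed

definition locally_optimal :: "nat \<Rightarrow> (nat \<Rightarrow> nat) \<Rightarrow> bool" where
  "locally_optimal q \<sigma> \<longleftrightarrow>
     (\<forall>js. length js = q \<and> set js \<subseteq> {..<m} \<longrightarrow> Phi \<sigma> \<le> Phi (foldl reassign \<sigma> js))"

text \<open>Induction on the potential. The second hypothesis concerns a store in which the loop
  exits at once: its assignment must already be locally optimal.\<close>

lemma runs_search:
  assumes "good s" "s 11 2 \<le> s 11 0 \<Longrightarrow> locally_optimal q (s 5)"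
  shows "runs (search_com q) s (5 + (Phi (s 5) + 1) * (scan_time z q q + 20)) (\<lambda>s'. good s' \<and> locally_optimal q (s' 5))"
  using assms
proof (induction "Phi (s 5)" arbitrary: s rule: less_induct)
  case less
  let ?Q = "\<lambda>s'. good s' \<and> locally_optimal q (s' 5)"
  show ?case
  proof (cases "s 11 0 < s 11 2")
    case False
    then show ?thesis
      unfolding search_com_def using less.prems by (intro runs_LoopF) auto
  next
    case True
    let ?s = "s(11 := (s 11)(2 := s 11 0))"
    have good: "good ?s"
      using less.prems(1) by (auto simp: good_def env_def ctx_def)
    have phi: "s 11 0 = Phi (s 5)"
      using less.prems(1) by (simp add: good_def)
    have "runs (scan_com q q) ?s (scan_time z q q)
        (progress q {js @ suffix q q ?s | js. length js = q \<and> set js \<subseteq> {..<m}} ?s)"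
      by (rule runs_scan[OF order_refl good]) auto
    then have "runs (scan_com q q) ?s (scan_time z q q)
        (\<lambda>s'. runs (search_com q) s' (5 + Phi (s 5) * (scan_time z q q + 20)) ?Q)"
    proof (rule runs_conseq)
      fix s' assume s': "progress q {js @ suffix q q ?s | js. length js = q \<and> set js \<subseteq> {..<m}} ?s s'"
      then have good': "good s'" and le: "Phi (s' 5) \<le> Phi (s 5)" and s'2: "s' 11 2 = Phi (s 5)"
        using phi by (auto simp: progress_def)
      have phi': "s' 11 0 = Phi (s' 5)"
        using good' by (simp add: good_def)
      show "runs (search_com q) s' (5 + Phi (s 5) * (scan_time z q q + 20)) ?Q"
      proof (cases "Phi (s' 5) = Phi (s 5)")
        case True
        then have "locally_optimal q (s' 5)"
          using s' by (auto simp: progress_def locally_optimal_def suffix_def)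
        then show ?thesis
          unfolding search_com_def using good' phi' s'2 True by (intro runs_LoopF) auto
      next
        case False
        then have lt: "Phi (s' 5) < Phi (s 5)"
          using le by simp
        then have "(Phi (s' 5) + 1) * (scan_time z q q + 20) \<le> Phi (s 5) * (scan_time z q q + 20)"
          by (intro mult_right_mono) auto
        moreover have "runs (search_com q) s' (5 + (Phi (s' 5) + 1) * (scan_time z q q + 20)) ?Q"
          using lt s'2 phi' by (intro less.hyps[OF lt good']) auto
        ultimately show ?thesis
          by (elim runs_conseq) auto
      qed
    qed simp
    then have "runs (Seq (Put 11 (Const 2) (Get 11 (Const 0))) (scan_com q q)) s (4 + scan_time z q q)
        (\<lambda>s'. runs (search_com q) s' (5 + Phi (s 5) * (scan_time z q q + 20)) ?Q)"
      by (intro runs_Seq[of _ _ 4] runs_Put) auto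
    then show ?thesis
      unfolding search_com_def using True by (intro runs_LoopT) auto
  qed
qed

lemma runs_output:
  assumes s: "good s"
  shows "runs output_com s (output_time z)
    (\<lambda>s'. \<forall>v. s' 4 v = (if T v = 1 \<or> v \<in> s 5 ` {e. elem e} then 1 else 0))"
proof -
  have eqs: "s 0 0 = n" "s 3 = T" "s 4 = (\<lambda>_. 0)" "s 6 = (\<lambda>v. if elem v then 1 else 0)"
    using s by (auto simp: good_def env_def ctx_def)
  let ?I = "\<lambda>i s'. (\<forall>x. x \<notin> {4, 10} \<longrightarrow> s' x = s x) \<and> s' 10 0 = i \<and>
    (\<forall>v. s' 4 v = (if v \<in> s 5 ` {e. elem e \<and> e < i} then 1 else T v))"
  show ?thesis
    unfolding output_com_def output_time_def
  proof (rule runs_Seq[OF runs_conseq[OF runs_copy]])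
    fix s' assume s': "s' 4 = s 3 \<and> (\<forall>x. x \<notin> {4, 10} \<longrightarrow> s' x = s x) \<and> (\<forall>k. k \<noteq> 0 \<longrightarrow> s' 10 k = s 10 k)"
    show "runs (For 0 0 (Cond (Equal (Get 6 (reg 0)) (Const 1)) (Put 4 (Get 5 (reg 0)) (Const 1)) Skip)) s'
      (10 + z * 30) (\<lambda>s'. \<forall>v. s' 4 v = (if T v = 1 \<or> v \<in> s 5 ` {e. elem e} then 1 else 0))"
    proof (rule runs_For[where I = ?I and N = n and T = 18])
      fix i t assume i: "i < n" and t: "?I i t"
      have "{e. elem e \<and> e < Suc i} = (if elem i then insert i {e. elem e \<and> e < i} else {e. elem e \<and> e < i})"
        by (auto simp: less_Suc_eq)
      moreover have "t 6 = (\<lambda>v. if elem v then 1 else 0)" "t 5 = s 5" "t 10 0 = i"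
        using t eqs by auto
      ultimately show "runs (Cond (Equal (Get 6 (reg 0)) (Const 1)) (Put 4 (Get 5 (reg 0)) (Const 1)) Skip) t 18
         (\<lambda>t'. t' 10 0 = i \<and> ?I (Suc i) (t'(10 := (t' 10)(0 := Suc i))))"
        using t by (intro runs_Cond[where T' = 6] runs_Put runs_Skip) (auto split: if_splits)
    next
      fix t assume t: "?I n t"
      have "{e. elem e \<and> e < n} = {e. elem e}"
        using elem_less by auto
      then show "\<forall>v. t 4 v = (if T v = 1 \<or> v \<in> s 5 ` {e. elem e} then 1 else 0)"
        using t T_le by (auto simp: le_Suc_eq)
    qed (use s' eqs n_le in auto)
  qed (use eqs T_outside in auto)
qed

lemma Phi_le: "Phi \<sigma> \<le> 495 * z"
proof -
  have "pot k \<le> 495" for k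
  proof -
    have "pot k \<le> pot (k + 6)"
      unfolding pot_def by (rule sum_mono2) auto
    then show ?thesis by (simp add: pot_ge_6)
  qed
  then have "Phi \<sigma> \<le> (\<Sum>c<n. 495)"
    unfolding Phi_def by (intro sum_mono)
  also have "\<dots> \<le> 495 * z"
    using n_le by simp
  finally show ?thesis .
qed

theorem runs_cover:
  assumes "ctx s" "\<And>x i. 4 \<le> x \<Longrightarrow> s x i = 0"
  shows "runs (cover_com q) s (total_time z q) (\<lambda>s'. \<exists>\<sigma>. locally_optimal q \<sigma> \<and> well \<sigma> \<and>
    (\<forall>v. elem v \<and> touched m v \<longrightarrow> linked \<sigma> v) \<and>
    (\<forall>v. s' 4 v = (if T v = 1 \<or> v \<in> \<sigma> ` {e. elem e} then 1 else 0)))" (is "runs _ _ _ ?Q")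
proof -
  have zero: "s x = (\<lambda>_. 0)" if "4 \<le> x" for x
    using assms(2) that by auto
  show ?thesis
    unfolding cover_com_def total_time_def
  proof (rule runs_Seq[OF runs_conseq[OF runs_table]])
    fix s1 assume s1: "s1 = s(9 := marg)"
    show "runs (Seq flag_com (Seq (For 0 1 (reassign_com 5 0)) (Seq (phi_com 5 0)
       (Seq (Put 11 (Const 2) (Plus (Get 11 (Const 0)) (Const 1))) (Seq (search_com q) output_com))))) s1
       (flag_time z + ((10 + z * 34) + (phi_time z + (6 + ((5 + (495 * z + 1) * (scan_time z q q + 20)) + output_time z))))) ?Q"
    proof (rule runs_Seq[OF runs_conseq[OF runs_flag]])
      fix s2 assume s2: "s2 6 = (\<lambda>v. if elem v then 1 else 0) \<and> (\<forall>x. x \<notin> {6, 10} \<longrightarrow> s2 x = s1 x)"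
      have env2: "env s2"
        using s1 s2 assms(1) zero by (auto simp: env_def ctx_def)
      let ?I = "\<lambda>i t. (\<forall>x. x \<notin> {5, 10} \<longrightarrow> t x = s2 x) \<and> t 10 0 = i \<and> well (t 5) \<and>
        (\<forall>v. elem v \<and> touched i v \<longrightarrow> linked (t 5) v)"
      have reass: "runs (For 0 1 (reassign_com 5 0)) s2 (10 + z * 34) (?I m)"
      proof (rule runs_For[where I = ?I and N = m and T = 22])
        have "s2 5 = (\<lambda>_. 0)"
          using s1 s2 zero by auto
        then show "?I 0 (s2(10 := (s2 10)(0 := 0)))"
          by (auto simp: well_def touched_def elem_def)
        fix i t assume i: "i < m" and t: "?I i t"
        have "env t"
          using env2 by (rule env_upd) (use t in auto)
        then show "runs (reassign_com 5 0) t 22 (\<lambda>t'. t' 10 0 = i \<and> ?I (Suc i) (t'(10 := (t' 10)(0 := Suc i))))"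
        proof (rule runs_conseq[OF runs_reassign])
          fix t' assume t': "t' = t(5 := reassign (t 5) (t 10 0))"
          have "touched (Suc i) v \<longleftrightarrow> touched i v \<or> v = A i \<or> v = B i" for v
            by (auto simp: touched_def less_Suc_eq)
          then show "t' 10 0 = i \<and> ?I (Suc i) (t'(10 := (t' 10)(0 := Suc i)))"
            using t t' i well_reassign linked_reassign linked_reassign_new by auto
        qed auto
      qed (use env2 m_le in \<open>auto simp: env_def ctx_def\<close>)
      show "runs (Seq (For 0 1 (reassign_com 5 0)) (Seq (phi_com 5 0)
         (Seq (Put 11 (Const 2) (Plus (Get 11 (Const 0)) (Const 1))) (Seq (search_com q) output_com)))) s2
         ((10 + z * 34) + (phi_time z + (6 + ((5 + (495 * z + 1) * (scan_time z q q + 20)) + output_time z)))) ?Q"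
      proof (rule runs_Seq[OF runs_conseq[OF reass]])
        fix s3 assume s3: "?I m s3"
        have env3: "env s3"
          using env2 by (rule env_upd) (use s3 in auto)
        show "runs (Seq (phi_com 5 0) (Seq (Put 11 (Const 2) (Plus (Get 11 (Const 0)) (Const 1)))
           (Seq (search_com q) output_com))) s3
           (phi_time z + (6 + ((5 + (495 * z + 1) * (scan_time z q q + 20)) + output_time z))) ?Q"
        proof (rule runs_Seq[OF runs_conseq[OF runs_phi[OF env3]]])
          fix s4 assume s4: "s4 11 = (s3 11)(0 := Phi (s3 5)) \<and> (\<forall>x. x \<notin> {8, 10, 11} \<longrightarrow> s4 x = s3 x) \<and>
            (\<forall>k. k \<noteq> 0 \<longrightarrow> s4 10 k = s3 10 k)"
          let ?s = "s4(11 := (s4 11)(2 := Suc (s4 11 0)))"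
          have "env ?s"
            using env3 by (rule env_upd) (use s4 in auto)
          moreover have "s4 7 = (\<lambda>_. 0)" "s4 5 = s3 5"
            using s1 s2 s3 s4 zero by auto
          ultimately have good: "good ?s"
            using s3 s4 by (auto simp: good_def)
          have "runs (search_com q) ?s (5 + (Phi (?s 5) + 1) * (scan_time z q q + 20))
              (\<lambda>s'. good s' \<and> locally_optimal q (s' 5))"
            by (rule runs_search[OF good]) auto
          then have search: "runs (search_com q) ?s (5 + (495 * z + 1) * (scan_time z q q + 20))
              (\<lambda>s'. runs output_com s' (output_time z) ?Q)"
          proof (rule runs_conseq)
            fix s5 assume s5: "good s5 \<and> locally_optimal q (s5 5)"
            show "runs output_com s5 (output_time z) ?Q"
            proof (rule runs_conseq[OF runs_output])
              fix s6 :: store assume "\<forall>v. s6 4 v = (if T v = 1 \<or> v \<in> s5 5 ` {e. elem e} then 1 else 0)"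
              then show "?Q s6"
                using s5 by (intro exI[of _ "s5 5"]) (auto simp: good_def)
            qed (use s5 in auto)
          next
            show "5 + (Phi (?s 5) + 1) * (scan_time z q q + 20) \<le> 5 + (495 * z + 1) * (scan_time z q q + 20)"
              by (intro add_left_mono mult_right_mono add_mono Phi_le) auto
          qed
          show "runs (Seq (Put 11 (Const 2) (Plus (Get 11 (Const 0)) (Const 1))) (Seq (search_com q) output_com)) s4
             (6 + ((5 + (495 * z + 1) * (scan_time z q q + 20)) + output_time z)) ?Q"
          proof (rule runs_Seq[where ?T1.0 = 6, OF runs_Put])
            show "runs (Seq (search_com q) output_com)
               (s4(11 := (s4 11)(aval (Const 2) s4 := aval (Plus (Get 11 (Const 0)) (Const 1)) s4)))
               ((5 + (495 * z + 1) * (scan_time z q q + 20)) + output_time z) ?Q"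
              using runs_Seq[OF search order_refl] by (simp only: aval.simps Suc_eq_plus1)
          qed auto
        qed (use s3 in \<open>auto simp: well_def\<close>)
      qed auto
    qed (use s1 assms zero in \<open>auto simp: ctx_def\<close>)
  qed (use zero in auto)
qed

end

subsection \<open>The approximation ratio\<close>

context graph_data
begin

text \<open>Edge \<open>j v\<close> joins the element \<open>v\<close> to \<open>\<tau> v\<close>,
  which is not an element; hence \<open>reassign\<close> moves \<open>v\<close> and nothing else.
  Repetitions in \<open>xs\<close> do no harm.\<close>

lemma foldl_reassign:
  assumes "\<And>v. v \<in> set xs \<Longrightarrow> elem v"
    and "\<And>v. v \<in> set xs \<Longrightarrow> j v < m \<and> (v = A (j v) \<and> \<tau> v = B (j v) \<or> v = B (j v) \<and> \<tau> v = A (j v))"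
  shows "foldl reassign \<sigma> (map j xs) = (\<lambda>v. if v \<in> set xs then \<tau> v else \<sigma> v)"
  using assms
proof (induction xs rule: rev_induct)
  case (snoc x xs)
  have "reassign \<rho> (j x) = \<rho>(x := \<tau> x)" for \<rho>
    using snoc.prems[of x] elem_not_both[of "j x"] by (auto simp: reassign_def)
  moreover have "foldl reassign \<sigma> (map j xs) = (\<lambda>v. if v \<in> set xs then \<tau> v else \<sigma> v)"
    using snoc.prems by (intro snoc.IH) auto
  ultimately show ?case
    by auto
qed simp

text \<open>The new fiber of \<open>c\<close> consists of what stays and what arrives. Subadditivity
  of \<open>pot\<close> separates the two, and local optimality of the program's output becomes the
  inequality between \<open>gain\<close> and \<open>cost\<close>.\<close>

lemma exchange_le:
  assumes opt: "locally_optimal q \<sigma>" and \<tau>: "\<And>v. elem v \<Longrightarrow> linked \<tau> v"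
    and X: "X \<subseteq> {v. elem v}" "card X \<le> q"
  shows "gain {v. elem v} {..<n} \<sigma> X \<le> cost {v. elem v} {..<n} \<tau> X"
proof (cases "X = {}")
  case False
  let ?E = "{v. elem v}"
  have finE: "finite ?E"
    by (rule finite_subset[of _ "{..<n}"]) (auto dest: elem_less)
  obtain xs where xs: "set xs = X" "length xs = card X"
    using finite_subset[OF X(1) finE] by (metis distinct_card finite_distinct_list)
  \<comment> \<open>Repeating an element brings the sequence to the exact length
    \<open>q\<close>.\<close>
  define ys where "ys = xs @ replicate (q - card X) (hd xs)"
  have "xs \<noteq> []"
    using False xs by auto
  then have ys: "set ys = X" "length ys = q"
    using xs X(2) by (auto simp: ys_def)
  have "\<forall>v\<in>?E. \<exists>j<m. v = A j \<and> \<tau> v = B j \<or> v = B j \<and> \<tau> v = A j"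
    using \<tau> by (simp add: linked_def)
  then obtain j where j: "\<And>v. elem v \<Longrightarrow> j v < m \<and> (v = A (j v) \<and> \<tau> v = B (j v) \<or> v = B (j v) \<and> \<tau> v = A (j v))"
    by (metis mem_Collect_eq)
  define \<rho> where "\<rho> v = (if v \<in> X then \<tau> v else \<sigma> v)" for v
  have "foldl reassign \<sigma> (map j ys) = \<rho>"
    unfolding \<rho>_def[abs_def] ys(1)[symmetric] using ys X j by (intro foldl_reassign) auto
  moreover have "set (map j ys) \<subseteq> {..<m}"
    using ys X j by auto
  ultimately have "Phi \<sigma> \<le> Phi \<rho>"
    using opt ys(2) unfolding locally_optimal_def by (metis length_map)
  also have "Phi \<rho> \<le> (\<Sum>c<n. pot (card (fiber ?E \<sigma> c - X)) + pot (card (fiber ?E \<tau> c \<inter> X)))"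
    unfolding Phi_def
  proof (rule sum_mono)
    fix c
    have "fiber ?E \<rho> c = (fiber ?E \<sigma> c - X) \<union> (fiber ?E \<tau> c \<inter> X)"
      by (auto simp: fiber_def \<rho>_def)
    moreover have "finite (fiber ?E \<sigma> c - X)" "finite (fiber ?E \<tau> c \<inter> X)"
      using finE by (auto simp: fiber_def)
    ultimately have "card (fiber ?E \<rho> c) = card (fiber ?E \<sigma> c - X) + card (fiber ?E \<tau> c \<inter> X)"
      by (simp add: card_Un_disjoint Int_Diff Diff_Int_distrib2 inf_assoc disjoint_iff)
    then show "pot (card (fiber ?E \<rho> c)) \<le> pot (card (fiber ?E \<sigma> c - X)) + pot (card (fiber ?E \<tau> c \<inter> X))"
      by (simp add: pot_subadditive)
  qed
  finally have "int (Phi \<sigma>) \<le> int (\<Sum>c<n. pot (card (fiber ?E \<sigma> c - X)) + pot (card (fiber ?E \<tau> c \<inter> X)))"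
    by (simp only: of_nat_le_iff)
  then show ?thesis
    by (simp add: gain_def cost_def Phi_def sum_subtractf sum.distrib)
qed simp

lemma image_size_bound:
  assumes "locally_optimal q \<sigma>" "well \<sigma>" "7 * radius 300 \<le> q" "\<And>v. elem v \<Longrightarrow> linked \<tau> v"
  shows "80820 * int (card (\<sigma> ` {v. elem v})) \<le>
    93300 * int (card (\<tau> ` {v. elem v})) + 12480 * int (card {v. elem v})"
proof -
  interpret local_optimum "{v. elem v}" "{..<n}" \<sigma> \<tau> q
  proof
    show "finite {v. elem v}"
      by (rule finite_subset[of _ "{..<n}"]) (auto dest: elem_less)
    show "\<sigma> e \<in> {..<n}" if "e \<in> {v. elem v}" for e
      using assms(2) that by (auto simp: well_def)
    show "\<tau> e \<in> {..<n}" if "e \<in> {v. elem v}" for e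
      using assms(4)[of e] that A_less B_less by (auto simp: linked_def)
    show "gain {v. elem v} {..<n} \<sigma> X \<le> cost {v. elem v} {..<n} \<tau> X" if "X \<subseteq> {v. elem v}" "card X \<le> q" for X
      by (rule exchange_le[OF assms(1,4) that])
  qed auto
  show ?thesis
    by (rule local_optimum_bound[OF assms(3)])
qed

end

section \<open>The running time as a polynomial\<close>

lemma poly_add_fun: "\<exists>p::nat poly. \<forall>x. poly p x = f x \<Longrightarrow> \<exists>p::nat poly. \<forall>x. poly p x = g x \<Longrightarrow> \<exists>p::nat poly. \<forall>x. poly p x = f x + g x"
  by (metis poly_add)

lemma poly_mult_fun: "\<exists>p::nat poly. \<forall>x. poly p x = f x \<Longrightarrow> \<exists>p::nat poly. \<forall>x. poly p x = g x \<Longrightarrow> \<exists>p::nat poly. \<forall>x. poly p x = f x * g x"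
  by (metis poly_mult)

lemma poly_const_fun: "\<exists>p::nat poly. \<forall>x. poly p x = c"
  by (rule exI[of _ "[:c:]"]) simp

lemma poly_id_fun: "\<exists>p::nat poly. \<forall>x. poly p x = x"
  by (rule exI[of _ "[:0, 1:]"]) simp

lemmas poly_fun_intros = poly_add_fun poly_mult_fun poly_const_fun poly_id_fun

lemma scan_time_poly: "\<exists>p::nat poly. \<forall>x. poly p x = scan_time x q i"
proof (induction i)
  case 0
  then show ?case
    unfolding scan_time.simps try_time_def copy_time_def phi_time_def by (intro poly_fun_intros)
next
  case (Suc i)
  then show ?case
    unfolding scan_time.simps by (intro poly_fun_intros)
qed

lemma total_time_poly: "\<exists>p::nat poly. \<forall>x. poly p x = total_time x q"
  unfolding total_time_def flag_time_def copy_time_def phi_time_def output_time_def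
  by (intro poly_fun_intros scan_time_poly)

section \<open>From instances to assignments of elements\<close>

locale cover_instance = graph_data +
  fixes I :: "(nat, nat) activation_instance"
  assumes valid: "valid_instance I" and unit: "unit_thresholds I"
    and verts_eq: "verts I = {..<n}" and edges_eq: "edges I = {..<m}"
    and ends_eq: "j < m \<Longrightarrow> ends I j = {A j, B j}"
    and terminal_iff: "v \<in> terminals I \<longleftrightarrow> T v = 1"
begin

lemma fin_terminals: "finite (terminals I)" and terminals_verts: "terminals I \<subseteq> verts I"
  using valid by (auto simp: valid_instance_def intro: finite_subset)

lemma activated_iff: "j \<in> activated_edges I a \<longleftrightarrow> j < m \<and> 1 \<le> a (A j) \<and> 1 \<le> a (B j)"
  using unit by (auto simp: activated_edges_def unit_thresholds_def edges_eq ends_eq)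

lemma elem_terminal: "elem v \<Longrightarrow> v \<in> terminals I"
  by (simp add: elem_def terminal_iff)

lemma linked_nonterminal: "elem v \<Longrightarrow> linked \<tau> v \<Longrightarrow> \<tau> v \<notin> terminals I"
  by (auto simp: elem_def linked_def terminal_iff)

text \<open>A solution is at least 1 on every terminal and on some neighbour of every element,
  chosen as \<open>\<tau>\<close>. These neighbours are not terminals, so both counts add
  up.\<close>

lemma solution_lower_bound:
  assumes "x \<in> edge_cover_assignments I"
  shows "\<exists>\<tau>. (\<forall>v. elem v \<longrightarrow> linked \<tau> v) \<and>
    real (card (terminals I)) + real (card (\<tau> ` {v. elem v})) \<le> assignment_value I x"
proof -
  have nonneg: "\<And>v. v \<in> verts I \<Longrightarrow> 0 \<le> x v"
    using assms by (simp add: edge_cover_assignments_def)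
  have cover: "\<exists>j<m. 1 \<le> x (A j) \<and> 1 \<le> x (B j) \<and> (v = A j \<or> v = B j)" if v: "v \<in> terminals I" for v
  proof -
    obtain j where "j \<in> activated_edges I x" "v \<in> ends I j"
      using assms v by (auto simp: edge_cover_assignments_def covers_def)
    then show ?thesis
      using activated_iff[of j x] ends_eq[of j] by auto
  qed
  have "\<forall>v\<in>{v. elem v}. \<exists>c. 1 \<le> x c \<and> (\<exists>j<m. v = A j \<and> c = B j \<or> v = B j \<and> c = A j)"
    using cover elem_terminal by blast
  then obtain \<tau> where \<tau>: "\<And>v. elem v \<Longrightarrow> 1 \<le> x (\<tau> v) \<and>
      (\<exists>j<m. v = A j \<and> \<tau> v = B j \<or> v = B j \<and> \<tau> v = A j)"
    by (metis mem_Collect_eq)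
  then have linked: "linked \<tau> v" if "elem v" for v
    using that by (auto simp: linked_def)
  let ?S = "terminals I \<union> \<tau> ` {v. elem v}"
  have finE: "finite {v. elem v}"
    by (rule finite_subset[OF _ fin_terminals]) (auto dest: elem_terminal)
  have S: "?S \<subseteq> verts I"
    using terminals_verts \<tau> A_less B_less verts_eq by fastforce
  have "real (card (terminals I)) + real (card (\<tau> ` {v. elem v})) = real (card ?S)"
    using linked linked_nonterminal fin_terminals finE by (subst card_Un_disjoint) auto
  also have "\<dots> = (\<Sum>v\<in>?S. 1)"
    by simp
  also have "\<dots> \<le> (\<Sum>v\<in>?S. x v)"
    using cover \<tau> by (intro sum_mono) auto
  also have "\<dots> \<le> assignment_value I x"
    unfolding assignment_value_def using S nonneg verts_eq by (intro sum_mono2) auto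
  finally show ?thesis
    using linked by blast
qed

lemma output_correct:
  assumes opt: "locally_optimal q \<sigma>" "well \<sigma>" "7 * radius 300 \<le> q"
    and linked: "\<And>v. elem v \<and> touched m v \<Longrightarrow> linked \<sigma> v"
    and out: "\<And>v. s' 4 v = (if T v = 1 \<or> v \<in> \<sigma> ` {e. elem e} then 1 else 0)"
    and feasible: "edge_cover_assignments I \<noteq> {}"
  shows "output_assignment s' \<in> edge_cover_assignments I"
    and "assignment_value I (output_assignment s') \<le>
      1555 / 1347 * (INF x\<in>edge_cover_assignments I. assignment_value I x)"
proof -
  let ?a = "output_assignment s'" and ?E = "{v. elem v}"
  have a: "?a v = (if v \<in> terminals I \<union> \<sigma> ` ?E then 1 else 0)" for v
    using out by (simp add: output_assignment_def terminal_iff)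
  have finE: "finite ?E"
    by (rule finite_subset[OF _ fin_terminals]) (auto dest: elem_terminal)
  \<comment> \<open>Any solution shows that every terminal lies on an edge, so that every element
    has been linked.\<close>
  obtain x0 where x0: "x0 \<in> edge_cover_assignments I"
    using feasible by auto
  have touched: "touched m v" if v: "v \<in> terminals I" for v
  proof -
    obtain j where "j \<in> activated_edges I x0" "v \<in> ends I j"
      using x0 v by (auto simp: edge_cover_assignments_def covers_def)
    then show ?thesis
      using activated_iff[of j x0] ends_eq[of j] by (auto simp: touched_def)
  qed
  have link: "linked \<sigma> v" if "elem v" for v
    using linked[of v] touched[of v] elem_terminal that by blast
  have "\<exists>j\<in>activated_edges I ?a. v \<in> ends I j" if v: "v \<in> terminals I" for v
  proof (cases "elem v")
    case True
    then obtain j where j: "j < m" "v = A j \<and> \<sigma> v = B j \<or> v = B j \<and> \<sigma> v = A j"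
      using link[OF True] by (auto simp: linked_def)
    have "1 \<le> ?a v" "1 \<le> ?a (\<sigma> v)"
      using v True by (auto simp: a)
    then show ?thesis
      using j by (intro bexI[of _ j]) (auto simp: activated_iff ends_eq)
  next
    case False
    then obtain j where j: "j < m" "T (A j) = 1" "T (B j) = 1" "v = A j \<or> v = B j"
      using v terminals_verts verts_eq by (auto simp: elem_def terminal_iff)
    then show ?thesis
      by (intro bexI[of _ j]) (auto simp: activated_iff ends_eq a terminal_iff)
  qed
  then show "?a \<in> edge_cover_assignments I"
    by (simp add: edge_cover_assignments_def covers_def a)
  have "\<sigma> ` ?E \<subseteq> verts I"
    using opt(2) verts_eq by (auto simp: well_def)
  then have sub: "verts I \<inter> (terminals I \<union> \<sigma> ` ?E) = terminals I \<union> \<sigma> ` ?E"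
    using terminals_verts by auto
  have "assignment_value I ?a = (\<Sum>v\<in>verts I. if v \<in> terminals I \<union> \<sigma> ` ?E then 1 else 0)"
    unfolding assignment_value_def a ..
  also have "\<dots> = (\<Sum>v\<in>verts I \<inter> (terminals I \<union> \<sigma> ` ?E). 1)"
    using verts_eq by (intro sum.inter_restrict[symmetric]) simp
  also have "\<dots> = real (card (terminals I \<union> \<sigma> ` ?E))"
    unfolding sub by simp
  also have "\<dots> \<le> real (card (terminals I)) + real (card (\<sigma> ` ?E))"
    using card_Un_le[of "terminals I" "\<sigma> ` ?E"] by linarith
  finally have output_le: "assignment_value I ?a \<le> real (card (terminals I)) + real (card (\<sigma> ` ?E))" .
  \<comment> \<open>The ratio is shown against each real solution separately and then passes to the
    infimum.\<close>
  have "1347 / 1555 * assignment_value I ?a \<le> assignment_value I x" if x: "x \<in> edge_cover_assignments I" for x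
  proof -
    obtain \<tau> where \<tau>: "\<And>v. elem v \<Longrightarrow> linked \<tau> v"
      "real (card (terminals I)) + real (card (\<tau> ` ?E)) \<le> assignment_value I x"
      using solution_lower_bound[OF x] by blast
    have "80820 * int (card (\<sigma> ` ?E)) \<le> 93300 * int (card (\<tau> ` ?E)) + 12480 * int (card ?E)"
      by (rule image_size_bound[OF opt \<tau>(1)])
    then have "80820 * real (card (\<sigma> ` ?E)) \<le> 93300 * real (card (\<tau> ` ?E)) + 12480 * real (card ?E)"
      by linarith
    moreover have "card ?E \<le> card (terminals I)"
      using elem_terminal fin_terminals by (intro card_mono) auto
    then have "real (card ?E) \<le> real (card (terminals I))"
      by simp
    ultimately show ?thesis
      using output_le \<tau>(2) by linarith
  qed
  then have "1347 / 1555 * assignment_value I ?a \<le> (INF x\<in>edge_cover_assignments I. assignment_value I x)"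
    by (intro cINF_greatest feasible)
  then show "assignment_value I ?a \<le> 1555 / 1347 * (INF x\<in>edge_cover_assignments I. assignment_value I x)"
    by linarith
qed

end

theorem theorem3:
  "admits_ratio {I. valid_instance I \<and> unit_thresholds I}
     edge_cover_assignments assignment_value
     instance_size represents output_assignment (1555 / 1347)"
proof -
  \<comment> \<open>\<open>q\<close> is independent of the instance, so \<open>cover_com q\<close>
    is a single program with a polynomial time bound.\<close>
  define q where "q = 7 * radius 300"
  obtain p :: "nat poly" where p: "\<And>x. poly p x = total_time x q"
    using total_time_poly[of q] by blast
  have "\<exists>t s'. exec (cover_com q) s t s' \<and> t \<le> poly p (instance_size I) \<and>
      (edge_cover_assignments I \<noteq> {} \<longrightarrow> output_assignment s' \<in> edge_cover_assignments I \<and>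
        assignment_value I (output_assignment s') \<le>
          1555 / 1347 * (INF x\<in>edge_cover_assignments I. assignment_value I x))"
    if I: "valid_instance I" "unit_thresholds I" and s: "represents I s" for I s
  proof -
    obtain n m A B T where input: "s 0 0 = n" "s 0 1 = m" "s 1 = A" "s 2 = B" "s 3 = T"
      by blast
    have repr: "verts I = {..<n}" "edges I = {..<m}" "\<And>j. j < m \<Longrightarrow> ends I j = {A j, B j}"
      "\<And>v. v < n \<Longrightarrow> T v = (if v \<in> terminals I then 1 else 0)" "\<And>v. n \<le> v \<Longrightarrow> T v = 0"
      using s unfolding represents_def input by (auto simp: not_less)
    have ends: "{A j, B j} \<subseteq> {..<n}" if "j < m" for j
      using I(1) repr(1,2) repr(3)[OF that] that unfolding valid_instance_def by (metis lessThan_iff)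
    have terminals: "terminals I \<subseteq> {..<n}"
      using I(1) repr(1) by (simp add: valid_instance_def)
    interpret cover_instance n m A B T "instance_size I" I
    proof
      show "A j < n" "B j < n" if "j < m" for j
        using ends[OF that] by auto
      show "T v \<le> 1" for v
        using repr(4,5)[of v] by (cases "v < n") auto
      show "v \<in> terminals I \<longleftrightarrow> T v = 1" for v
        using repr(4,5)[of v] terminals by (cases "v < n") auto
    qed (use I repr in \<open>auto simp: instance_size_def\<close>)
    have "ctx s" "\<And>x i. 4 \<le> x \<Longrightarrow> s x i = 0"
      using s input by (auto simp: ctx_def represents_def)
    from runs_cover[OF this, of q] obtain t s' \<sigma> where run: "exec (cover_com q) s t s'"
        "t \<le> total_time (instance_size I) q"
      and \<sigma>: "locally_optimal q \<sigma>" "well \<sigma>" "\<And>v. elem v \<and> touched m v \<Longrightarrow> linked \<sigma> v"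
        "\<And>v. s' 4 v = (if T v = 1 \<or> v \<in> \<sigma> ` {e. elem e} then 1 else 0)"
      unfolding runs_def by blast
    then show ?thesis
      using output_correct[of q \<sigma> s'] p by (auto simp: q_def)
  qed
  then show ?thesis
    unfolding admits_ratio_def by blast
qed

end
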